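(* Let $\alpha\in\mathbb{R}$ and $h\in Z\hat C(\Delta_T^3;B_\alpha)$. Then the map $$\mathcal T_h:\{R\in C(\Delta_T^2;B_\alpha)\mid\hat\delta R=h\}\to\{\text{compatible frozen increment families over }h\},\qquad \mathcal T_h(R):=(\Theta_\tau R)_{\tau\in[0,T]},$$ is a bijection. Its inverse is given by $(r^\tau)_{\tau\in[0,T]}\mapsto R$, $R_{ts}:=r^t_{ts}$. In addition, if $\gamma\in(0,1)$ and $h\in Z\hat C^{\gamma}(\Delta_T^3;B_\alpha)$, then $\mathcal T_h$ restricts to a bijection between $\{R\in E^{\gamma}(\Delta_T^2;B_\alpha)\mid\hat\delta R=h\}$ and the compatible frozen increment families over $h$ satisfying $$\sup_{\tau\in[0,T]}\|r^\tau\|_{\gamma-\varepsilon,\alpha+\varepsilon;\tau}<\infty\quad\text{for all }\varepsilon\in(0,\gamma).$$ Likewise, if $h\in Z\hat C^{1}(\Delta_T^3;B_\alpha)$, then $\mathcal T_h$ restricts to a bijection between $\{R\in E^1_{\log}(\Delta_T^2;B_\alpha)\mid\hat\delta R=h\}$ and the compatible frozen increment families over $h$ satisfying $$\sup_{\tau\in[0,T]}\|r^\tau\|_{1,\log;\tau,\alpha}+\sup_{\tau\in[0,T]}\|r^\tau\|_{1-\varepsilon,\alpha+\varepsilon;\tau}<\infty\quad\text{for all }\varepsilon\in(0,1).$$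
   Context: Fix $T>0$. $(B_\alpha)_{\alpha\in\mathbb{R}}$ is a Banach scale, i.e. a family of Banach spaces such that for $\alpha\le\beta$ the embedding $B_\beta\hookrightarrow B_\alpha$ is continuous. $S=(S_t)_{t\ge0}$ is an analytic (in particular strongly continuous) semigroup of bounded linear operators acting on this scale, with $S_0=\mathrm{Id}$; for every $\alpha\in\mathbb{R}$, $\varepsilon\in(0,1)$ there is $C_{\alpha,\varepsilon,T}>0$ with $\|S_tx\|_{B_{\alpha+\varepsilon}}\le C_{\alpha,\varepsilon,T}t^{-\varepsilon}\|x\|_{B_\alpha}$ and $\|(S_t-\mathrm{Id})x\|_{B_\alpha}\le C_{\alpha,\varepsilon,T}t^{\varepsilon}\|x\|_{B_{\alpha+\varepsilon}}$ for all $t\in(0,T]$. For $\tau\in[0,T]$, $\Delta_\tau^n:=\{(t_1,\dots,t_n)\in[0,\tau]^n: 0\le t_n\le\dots\le t_1\le\tau\}$; $C(\Delta_\tau^n;B_\alpha)$ is the space of continuous maps $\Delta_\tau^n\to B_\alpha$. $(\delta g)_{t_1\dots t_{n+1}}:=\sum_{i=1}^{n+1}(-1)^i g_{t_1\dots\hat t_i\dots t_{n+1}}$, and on $C(\Delta_T^n;B_\alpha)$, $(\hat\delta g)_{t_1\dots t_{n+1}}:=(\delta g)_{t_1\dots t_{n+1}}-(S_{t_1-t_2}-\mathrm{Id})g_{t_2\dots t_{n+1}}$. $Z\hat C(\Delta_T^3;B_\alpha):=\ker\hat\delta\cap C(\Delta_T^3;B_\alpha)$. Norms: for $g\in C(\Delta_\tau^2;B_\beta)$,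 $\|g\|_{\mu,\beta;\tau}:=\sup_{0\le s<t\le\tau}\|g_{ts}\|_{B_\beta}/|t-s|^\mu$ and $\|g\|_{1,\log;\tau,\beta}:=\sup_{0\le s<t\le\tau}\frac{\|g_{ts}\|_{B_\beta}}{|t-s|(1+|\log|t-s||)}$; $C^\mu(\Delta_\tau^2;B_\beta)$ and $C^1_{\log}(\Delta_\tau^2;B_\beta)$ are the subsets of $C(\Delta_\tau^2;B_\beta)$ on which these are finite. Finiteness of $\|r^\tau\|_{\mu,\beta;\tau}$ is understood as including $r^\tau\in C^\mu(\Delta_\tau^2;B_\beta)$. $C^\mu(\Delta_T^3;B_\alpha)$ is the set of $h\in C(\Delta_T^3;B_\alpha)$ with $\|h\|_{\mu,\alpha}:=\inf\{\sum_{j=1}^m\sup_{0\le s<u<t\le T}\frac{\|h_{j,tus}\|_{B_\alpha}}{|t-u|^{\rho_j}|u-s|^{\mu-\rho_j}}: h=\sum_{j=1}^m h_j,\ m\in\mathbb{N},\ 0<\rho_j<\mu\}<\infty$, and $Z\hat C^\mu(\Delta_T^3;B_\alpha):=Z\hat C(\Delta_T^3;B_\alpha)\cap C^\mu(\Delta_T^3;B_\alpha)$. $E^{\gamma}(\Delta_T^2;B_\alpha):=\bigcap_{0<\varepsilon<\gamma}C^{\gamma-\varepsilon}(\Delta_T^2;B_{\alpha+\varepsilon})$ for $\gamma\in(0,1)$; $E^1_{\log}(\Delta_T^2;B_\alpha):=C^1_{\log}(\Delta_T^2;B_\alpha)\cap\bigcap_{0<\varepsilon<1}C^{1-\varepsilon}(\Delta_T^2;B_{\alpha+\varepsilon})$.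 Frozen terminal-time transform: for $n\ge2$, $\Theta_\tau:C(\Delta_T^n;B_\alpha)\to C(\Delta_\tau^n;B_\alpha)$, $(\Theta_\tau g)_{t_1\dots t_n}:=S_{\tau-t_1}g_{t_1\dots t_n}$. Put $h^\tau:=\Theta_\tau h$. A compatible frozen increment family over $h$ is a family $r=(r^\tau)_{\tau\in[0,T]}$ such that: (a) $r^\tau\in C(\Delta_\tau^2;B_\alpha)$ for every $\tau$; (b) the map $\{(\tau,t,s)\in[0,T]^3:0\le s\le t\le\tau\le T\}\to B_\alpha$, $(\tau,t,s)\mapsto r^\tau_{ts}$, is continuous; (c) $\delta r^\tau=h^\tau$ for every $\tau$; (d) $r^\tau_{ts}=S_{\tau-\tau'}r^{\tau'}_{ts}$ for all $0\le s\le t\le\tau'\le\tau\le T$. *)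

theory Defs
  imports "HOL-Analysis.Analysis"
begin

text \<open>
  The spaces of a scale are subspaces \<open>B \<alpha>\<close> of one ambient real vector space, each with its own
  norm \<open>N \<alpha>\<close>, and the embeddings are inclusions (for an abstract scale of injective, compatible
  embeddings, take the direct limit as \<open>\<alpha> \<rightarrow> -\<infinity>\<close> as ambient space). Complex scales are covered by
  restriction of scalars. The values of \<open>N \<alpha>\<close> outside \<open>B \<alpha>\<close> are irrelevant.
\<close>

definition norm_on :: "'a::real_vector set \<Rightarrow> ('a \<Rightarrow> real) \<Rightarrow> bool" where
  "norm_on V N \<longleftrightarrow> subspace V \<and>
     (\<forall>x\<in>V. 0 \<le> N x \<and> (N x = 0 \<longleftrightarrow> x = 0)) \<and>
     (\<forall>c. \<forall>x\<in>V. N (c *\<^sub>R x) = \<bar>c\<bar> * N x) \<and>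
     (\<forall>x\<in>V. \<forall>y\<in>V. N (x + y) \<le> N x + N y)"

text \<open>The locale \<^locale>\<open>Metric_space\<close> wants nonnegativity and symmetry also outside the carrier.\<close>

definition norm_dist :: "'a::real_vector set \<Rightarrow> ('a \<Rightarrow> real) \<Rightarrow> 'a \<Rightarrow> 'a \<Rightarrow> real" where
  "norm_dist V N x y = (if x \<in> V \<and> y \<in> V then N (x - y) else 0)"

definition norm_topology :: "'a::real_vector set \<Rightarrow> ('a \<Rightarrow> real) \<Rightarrow> 'a topology" where
  "norm_topology V N = Metric_space.mtopology V (norm_dist V N)"

definition banach_on :: "'a::real_vector set \<Rightarrow> ('a \<Rightarrow> real) \<Rightarrow> bool" where
  "banach_on V N \<longleftrightarrow> norm_on V N \<and> Metric_space.mcomplete V (norm_dist V N)"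

definition banach_scale :: "(real \<Rightarrow> 'a::real_vector set) \<Rightarrow> (real \<Rightarrow> 'a \<Rightarrow> real) \<Rightarrow> bool" where
  "banach_scale B N \<longleftrightarrow>
     (\<forall>\<alpha>. banach_on (B \<alpha>) (N \<alpha>)) \<and>
     (\<forall>\<alpha> \<beta>. \<alpha> \<le> \<beta> \<longrightarrow> B \<beta> \<subseteq> B \<alpha> \<and> (\<exists>C. \<forall>x\<in>B \<beta>. N \<alpha> x \<le> C * N \<beta> x))"

definition bounded_operator_on :: "'a::real_vector set \<Rightarrow> ('a \<Rightarrow> real) \<Rightarrow> ('a \<Rightarrow> 'a) \<Rightarrow> bool" where
  "bounded_operator_on V N L \<longleftrightarrow>
     (\<forall>x\<in>V. L x \<in> V) \<and>
     (\<forall>x\<in>V. \<forall>y\<in>V. L (x + y) = L x + L y) \<and>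
     (\<forall>c. \<forall>x\<in>V. L (c *\<^sub>R x) = c *\<^sub>R L x) \<and>
     (\<exists>C. \<forall>x\<in>V. N (L x) \<le> C * N x)"

definition C0_semigroup_on ::
    "'a::real_vector set \<Rightarrow> ('a \<Rightarrow> real) \<Rightarrow> (real \<Rightarrow> 'a \<Rightarrow> 'a) \<Rightarrow> bool" where
  "C0_semigroup_on V N S \<longleftrightarrow>
     (\<forall>t\<ge>0. bounded_operator_on V N (S t)) \<and>
     (\<forall>x\<in>V. S 0 x = x) \<and>
     (\<forall>s\<ge>0. \<forall>t\<ge>0. \<forall>x\<in>V. S (s + t) x = S s (S t x)) \<and>
     (\<forall>x\<in>V. continuous_map (top_of_set {0..}) (norm_topology V N) (\<lambda>t. S t x))"

text \<open>
  A semigroup is analytic if it extends to a semigroup of bounded complex-linear operators on a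
  sector around the positive half-line which is holomorphic there and strongly continuous at the
  vertex. For real spaces this is meant on the complexification, here modelled as \<open>V \<times> V\<close> with
  \<open>(x, y)\<close> standing for \<open>x + iy\<close>. The functional \<open>cplx_norm N\<close> is not homogeneous under complex
  scalars, but it is equivalent to any of the usual complexified norms, so it yields the same
  bounded operators and the same limits. If \<open>V\<close> is already complex, its complexification is
  the direct sum of \<open>V\<close> and the conjugate space, and the notion is the usual one.
\<close>

definition cplx_scale :: "complex \<Rightarrow> 'a::real_vector \<times> 'a \<Rightarrow> 'a \<times> 'a" where
  "cplx_scale c p = (Re c *\<^sub>R fst p - Im c *\<^sub>R snd p, Re c *\<^sub>R snd p + Im c *\<^sub>R fst p)"

definition cplx_norm :: "('a \<Rightarrow> real) \<Rightarrow> 'a \<times> 'a \<Rightarrow> real" where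
  "cplx_norm N p = N (fst p) + N (snd p)"

definition sector :: "real \<Rightarrow> complex set" where
  "sector \<theta> = {z. z \<noteq> 0 \<and> \<bar>Arg z\<bar> < \<theta>}"

definition analytic_semigroup_on ::
    "'a::real_vector set \<Rightarrow> ('a \<Rightarrow> real) \<Rightarrow> (real \<Rightarrow> 'a \<Rightarrow> 'a) \<Rightarrow> bool" where
  "analytic_semigroup_on V N S \<longleftrightarrow>
     C0_semigroup_on V N S \<and>
     (\<exists>\<theta> E. 0 < \<theta> \<and> \<theta> \<le> pi / 2 \<and>
       (\<forall>z\<in>sector \<theta>. bounded_operator_on (V \<times> V) (cplx_norm N) (E z) \<and>
          (\<forall>c. \<forall>p\<in>V \<times> V. E z (cplx_scale c p) = cplx_scale c (E z p))) \<and>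
       (\<forall>t>0. \<forall>x\<in>V. \<forall>y\<in>V. E (complex_of_real t) (x, y) = (S t x, S t y)) \<and>
       (\<forall>z\<in>sector \<theta>. \<forall>w\<in>sector \<theta>. \<forall>p\<in>V \<times> V. E (z + w) p = E z (E w p)) \<and>
       (\<forall>z\<in>sector \<theta>. \<forall>p\<in>V \<times> V. \<exists>d\<in>V \<times> V.
          ((\<lambda>w. cplx_norm N (E w p - E z p - cplx_scale (w - z) d) / cmod (w - z)) \<longlongrightarrow> 0) (at z)) \<and>
       (\<forall>p\<in>V \<times> V. ((\<lambda>z. cplx_norm N (E z p - p)) \<longlongrightarrow> 0) (at 0 within sector \<theta>)))"

definition smoothing_on_scale ::
    "real \<Rightarrow> (real \<Rightarrow> 'a::real_vector set) \<Rightarrow> (real \<Rightarrow> 'a \<Rightarrow> real) \<Rightarrow> (real \<Rightarrow> 'a \<Rightarrow> 'a) \<Rightarrow> bool" where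
  "smoothing_on_scale T B N S \<longleftrightarrow>
     (\<forall>\<alpha>. \<forall>\<epsilon>\<in>{0<..<1}. \<exists>C>0. \<forall>t\<in>{0<..T}.
        (\<forall>x\<in>B \<alpha>. S t x \<in> B (\<alpha> + \<epsilon>) \<and> N (\<alpha> + \<epsilon>) (S t x) \<le> C * t powr (- \<epsilon>) * N \<alpha> x) \<and>
        (\<forall>x\<in>B (\<alpha> + \<epsilon>). N \<alpha> (S t x - x) \<le> C * t powr \<epsilon> * N (\<alpha> + \<epsilon>) x))"

definition analytic_semigroup_on_scale ::
    "real \<Rightarrow> (real \<Rightarrow> 'a::real_vector set) \<Rightarrow> (real \<Rightarrow> 'a \<Rightarrow> real) \<Rightarrow> (real \<Rightarrow> 'a \<Rightarrow> 'a) \<Rightarrow> bool" where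
  "analytic_semigroup_on_scale T B N S \<longleftrightarrow>
     (\<forall>\<alpha>. analytic_semigroup_on (B \<alpha>) (N \<alpha>) S) \<and> smoothing_on_scale T B N S"

text \<open>
  A point \<open>(t\<^sub>1, \<dots>, t\<^sub>n)\<close> of the simplex is the decreasing list \<open>[t\<^sub>1, \<dots>, t\<^sub>n]\<close>, so \<open>g\<^sub>t\<^sub>s\<close> is written
  \<open>g [t, s]\<close>. Maps on the simplex are \<^const>\<open>extensional\<close> functions, so that equality of maps
  on the simplex is equality in HOL.
\<close>

definition simplex_times :: "nat \<Rightarrow> real \<Rightarrow> real list set" where
  "simplex_times n \<tau> = {ts. length ts = n \<and> set ts \<subseteq> {0..\<tau>} \<and> sorted_wrt (\<ge>) ts}"

definition simplex_topology :: "nat \<Rightarrow> real \<Rightarrow> real list topology" where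
  "simplex_topology n \<tau> = pullback_topology (simplex_times n \<tau>)
     (\<lambda>ts i. if i < n then ts ! i else 0) (Euclidean_space n)"

definition cont_incr :: "nat \<Rightarrow> real \<Rightarrow> 'a::real_vector set \<Rightarrow> ('a \<Rightarrow> real) \<Rightarrow> (real list \<Rightarrow> 'a) set" where
  "cont_incr n \<tau> V N = {g \<in> extensional (simplex_times n \<tau>).
     continuous_map (simplex_topology n \<tau>) (norm_topology V N) g}"

text \<open>The list \<open>take (i - 1) ts @ drop i ts\<close> is \<open>ts\<close> with its \<open>i\<close>-th entry (counted from 1) omitted.\<close>

definition delta :: "nat \<Rightarrow> real \<Rightarrow> (real list \<Rightarrow> 'a::real_vector) \<Rightarrow> real list \<Rightarrow> 'a" where
  "delta n \<tau> g = (\<lambda>ts\<in>simplex_times (n + 1) \<tau>.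
     \<Sum>i=1..n + 1. (- 1) ^ i *\<^sub>R g (take (i - 1) ts @ drop i ts))"

definition delta_hat ::
    "(real \<Rightarrow> 'a \<Rightarrow> 'a) \<Rightarrow> nat \<Rightarrow> real \<Rightarrow> (real list \<Rightarrow> 'a::real_vector) \<Rightarrow> real list \<Rightarrow> 'a" where
  "delta_hat S n \<tau> g = (\<lambda>ts\<in>simplex_times (n + 1) \<tau>.
     delta n \<tau> g ts - (S (ts ! 0 - ts ! 1) (g (tl ts)) - g (tl ts)))"

definition ZC3 ::
    "(real \<Rightarrow> 'a \<Rightarrow> 'a) \<Rightarrow> real \<Rightarrow> 'a::real_vector set \<Rightarrow> ('a \<Rightarrow> real) \<Rightarrow> (real list \<Rightarrow> 'a) set" where
  "ZC3 S T V N = {h \<in> cont_incr 3 T V N. \<forall>ts\<in>simplex_times 4 T. delta_hat S 3 T h ts = 0}"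

text \<open>
  Hoelder-type norms take values in \<^typ>\<open>ennreal\<close>, where the supremum over the empty set is 0. They
  only mean what they should on increments with values in the normed space, so finiteness is always
  stated together with membership in \<^const>\<open>cont_incr\<close>.
\<close>

definition holder_norm :: "real \<Rightarrow> ('a \<Rightarrow> real) \<Rightarrow> real \<Rightarrow> (real list \<Rightarrow> 'a) \<Rightarrow> ennreal" where
  "holder_norm \<tau> N \<mu> g =
     (SUP (t, s)\<in>{(t, s). 0 \<le> s \<and> s < t \<and> t \<le> \<tau>}. ennreal (N (g [t, s]) / \<bar>t - s\<bar> powr \<mu>))"

definition log_norm :: "real \<Rightarrow> ('a \<Rightarrow> real) \<Rightarrow> (real list \<Rightarrow> 'a) \<Rightarrow> ennreal" where
  "log_norm \<tau> N g =
     (SUP (t, s)\<in>{(t, s). 0 \<le> s \<and> s < t \<and> t \<le> \<tau>}.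
        ennreal (N (g [t, s]) / (\<bar>t - s\<bar> * (1 + \<bar>ln \<bar>t - s\<bar>\<bar>))))"

definition C_holder ::
    "real \<Rightarrow> real \<Rightarrow> 'a::real_vector set \<Rightarrow> ('a \<Rightarrow> real) \<Rightarrow> (real list \<Rightarrow> 'a) set" where
  "C_holder \<mu> \<tau> V N = {g \<in> cont_incr 2 \<tau> V N. holder_norm \<tau> N \<mu> g < \<infinity>}"

definition C_log :: "real \<Rightarrow> 'a::real_vector set \<Rightarrow> ('a \<Rightarrow> real) \<Rightarrow> (real list \<Rightarrow> 'a) set" where
  "C_log \<tau> V N = {g \<in> cont_incr 2 \<tau> V N. log_norm \<tau> N g < \<infinity>}"

definition holder_norm3_split :: "real \<Rightarrow> ('a \<Rightarrow> real) \<Rightarrow> real \<Rightarrow> real \<Rightarrow> (real list \<Rightarrow> 'a) \<Rightarrow> ennreal" where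
  "holder_norm3_split T N \<rho> \<sigma> h =
     (SUP (t, u, s)\<in>{(t, u, s). 0 \<le> s \<and> s < u \<and> u < t \<and> t \<le> T}.
        ennreal (N (h [t, u, s]) / (\<bar>t - u\<bar> powr \<rho> * \<bar>u - s\<bar> powr \<sigma>)))"

definition holder_norm3 ::
    "real \<Rightarrow> 'a::real_vector set \<Rightarrow> ('a \<Rightarrow> real) \<Rightarrow> real \<Rightarrow> (real list \<Rightarrow> 'a) \<Rightarrow> ennreal" where
  "holder_norm3 T V N \<mu> h =
     Inf {\<Sum>j<m. holder_norm3_split T N (\<rho> j) (\<mu> - \<rho> j) (k j) | (m::nat) \<rho> k.
            (\<forall>j<m. k j \<in> cont_incr 3 T V N \<and> 0 < \<rho> j \<and> \<rho> j < \<mu>) \<and>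
            (\<forall>ts\<in>simplex_times 3 T. h ts = (\<Sum>j<m. k j ts))}"

definition C_holder3 ::
    "real \<Rightarrow> real \<Rightarrow> 'a::real_vector set \<Rightarrow> ('a \<Rightarrow> real) \<Rightarrow> (real list \<Rightarrow> 'a) set" where
  "C_holder3 \<mu> T V N = {h \<in> cont_incr 3 T V N. holder_norm3 T V N \<mu> h < \<infinity>}"

definition ZC3_holder ::
    "(real \<Rightarrow> 'a \<Rightarrow> 'a) \<Rightarrow> real \<Rightarrow> real \<Rightarrow> 'a::real_vector set \<Rightarrow> ('a \<Rightarrow> real) \<Rightarrow> (real list \<Rightarrow> 'a) set" where
  "ZC3_holder S \<mu> T V N = ZC3 S T V N \<inter> C_holder3 \<mu> T V N"

definition E_space ::
    "real \<Rightarrow> real \<Rightarrow> (real \<Rightarrow> 'a::real_vector set) \<Rightarrow> (real \<Rightarrow> 'a \<Rightarrow> real) \<Rightarrow> real \<Rightarrow> (real list \<Rightarrow> 'a) set" where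
  "E_space \<gamma> T B N \<alpha> = (\<Inter>\<epsilon>\<in>{0<..<\<gamma>}. C_holder (\<gamma> - \<epsilon>) T (B (\<alpha> + \<epsilon>)) (N (\<alpha> + \<epsilon>)))"

definition E_log_space ::
    "real \<Rightarrow> (real \<Rightarrow> 'a::real_vector set) \<Rightarrow> (real \<Rightarrow> 'a \<Rightarrow> real) \<Rightarrow> real \<Rightarrow> (real list \<Rightarrow> 'a) set" where
  "E_log_space T B N \<alpha> = C_log T (B \<alpha>) (N \<alpha>) \<inter>
     (\<Inter>\<epsilon>\<in>{0<..<1}. C_holder (1 - \<epsilon>) T (B (\<alpha> + \<epsilon>)) (N (\<alpha> + \<epsilon>)))"

definition Theta ::
    "(real \<Rightarrow> 'a \<Rightarrow> 'a) \<Rightarrow> nat \<Rightarrow> real \<Rightarrow> (real list \<Rightarrow> 'a) \<Rightarrow> real list \<Rightarrow> 'a" where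
  "Theta S n \<tau> g = (\<lambda>ts\<in>simplex_times n \<tau>. S (\<tau> - ts ! 0) (g ts))"

definition frozen_families ::
    "(real \<Rightarrow> 'a \<Rightarrow> 'a) \<Rightarrow> real \<Rightarrow> 'a::real_vector set \<Rightarrow> ('a \<Rightarrow> real) \<Rightarrow> (real list \<Rightarrow> 'a)
      \<Rightarrow> (real \<Rightarrow> real list \<Rightarrow> 'a) set" where
  "frozen_families S T V N h = {r \<in> extensional {0..T}.
     (\<forall>\<tau>\<in>{0..T}. r \<tau> \<in> cont_incr 2 \<tau> V N) \<and>
     continuous_map (top_of_set {(\<tau>, t, s). 0 \<le> s \<and> s \<le> t \<and> t \<le> \<tau> \<and> \<tau> \<le> T})
       (norm_topology V N) (\<lambda>(\<tau>, t, s). r \<tau> [t, s]) \<and>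
     (\<forall>\<tau>\<in>{0..T}. delta 2 \<tau> (r \<tau>) = Theta S 3 \<tau> h) \<and>
     (\<forall>s t \<tau>' \<tau>. 0 \<le> s \<and> s \<le> t \<and> t \<le> \<tau>' \<and> \<tau>' \<le> \<tau> \<and> \<tau> \<le> T \<longrightarrow>
        r \<tau> [t, s] = S (\<tau> - \<tau>') (r \<tau>' [t, s]))}"

definition frozen_map ::
    "(real \<Rightarrow> 'a \<Rightarrow> 'a) \<Rightarrow> real \<Rightarrow> (real list \<Rightarrow> 'a) \<Rightarrow> real \<Rightarrow> real list \<Rightarrow> 'a" where
  "frozen_map S T R = (\<lambda>\<tau>\<in>{0..T}. Theta S 2 \<tau> R)"

text \<open>Here \<open>ts ! 0\<close> is the later of the two times: \<open>R\<^sub>t\<^sub>s = r\<^sup>t\<^sub>t\<^sub>s\<close>.\<close>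

definition unfreeze :: "real \<Rightarrow> (real \<Rightarrow> real list \<Rightarrow> 'a) \<Rightarrow> real list \<Rightarrow> 'a" where
  "unfreeze T r = (\<lambda>ts\<in>simplex_times 2 T. r (ts ! 0) ts)"

definition frozen_holder ::
    "real \<Rightarrow> real \<Rightarrow> (real \<Rightarrow> 'a::real_vector set) \<Rightarrow> (real \<Rightarrow> 'a \<Rightarrow> real) \<Rightarrow> real
      \<Rightarrow> (real \<Rightarrow> real list \<Rightarrow> 'a) \<Rightarrow> bool" where
  "frozen_holder \<gamma> T B N \<alpha> r \<longleftrightarrow> (\<forall>\<epsilon>\<in>{0<..<\<gamma>}.
     (\<forall>\<tau>\<in>{0..T}. r \<tau> \<in> C_holder (\<gamma> - \<epsilon>) \<tau> (B (\<alpha> + \<epsilon>)) (N (\<alpha> + \<epsilon>))) \<and>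
     (SUP \<tau>\<in>{0..T}. holder_norm \<tau> (N (\<alpha> + \<epsilon>)) (\<gamma> - \<epsilon>) (r \<tau>)) < \<infinity>)"

definition frozen_log ::
    "real \<Rightarrow> (real \<Rightarrow> 'a::real_vector set) \<Rightarrow> (real \<Rightarrow> 'a \<Rightarrow> real) \<Rightarrow> real
      \<Rightarrow> (real \<Rightarrow> real list \<Rightarrow> 'a) \<Rightarrow> bool" where
  "frozen_log T B N \<alpha> r \<longleftrightarrow> (\<forall>\<epsilon>\<in>{0<..<1}.
     (\<forall>\<tau>\<in>{0..T}. r \<tau> \<in> C_log \<tau> (B \<alpha>) (N \<alpha>) \<and>
                    r \<tau> \<in> C_holder (1 - \<epsilon>) \<tau> (B (\<alpha> + \<epsilon>)) (N (\<alpha> + \<epsilon>))) \<and>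
     (SUP \<tau>\<in>{0..T}. log_norm \<tau> (N \<alpha>) (r \<tau>)) +
       (SUP \<tau>\<in>{0..T}. holder_norm \<tau> (N (\<alpha> + \<epsilon>)) (1 - \<epsilon>) (r \<tau>)) < \<infinity>)"

end

theory Submission
  imports Defs
begin

text \<open>
  Everything rests on the identity \<open>\<delta>(\<Theta>\<^sub>\<tau> R) = \<Theta>\<^sub>\<tau>(\<delta>' R)\<close>, where \<open>\<delta>'\<close> stands for
  \<^const>\<open>delta_hat\<close>: the semigroup law turns the term \<open>S\<^sub>\<tau>\<^sub>-\<^sub>u R\<^sub>u\<^sub>s\<close> of \<open>\<delta>(\<Theta>\<^sub>\<tau> R)\<^sub>t\<^sub>u\<^sub>s\<close> into
  \<open>S\<^sub>\<tau>\<^sub>-\<^sub>t S\<^sub>t\<^sub>-\<^sub>u R\<^sub>u\<^sub>s\<close>, so that \<open>S\<^sub>\<tau>\<^sub>-\<^sub>t\<close> factors out (lemma \<open>delta_Theta\<close>). As \<open>S\<^sub>0\<close> is the identity, the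
  diagonal \<open>r\<^sup>t\<^sub>t\<^sub>s\<close> of the family of \<open>R\<close> is \<open>R\<^sub>t\<^sub>s\<close>; conversely the compatibility relation says that a
  family is determined by its diagonal. Joint continuity of \<open>(\<tau>, t, s) \<mapsto> S\<^sub>\<tau>\<^sub>-\<^sub>t R\<^sub>t\<^sub>s\<close> combines
  strong continuity with a uniform bound of the operators \<open>S\<^sub>t\<close>, \<open>t \<in> [0, T]\<close>, which the
  Banach-Steinhaus theorem provides
  (lemmas \<open>uniformly_bounded_on_compact_times\<close> and \<open>continuous_map_semigroup_action\<close>).

  For the regularity classes, the same uniform bound estimates the norm of each \<open>r\<^sup>\<tau>\<close> by that of \<open>R\<close>,
  and the diagonal \<open>R\<^sub>t\<^sub>s = r\<^sup>t\<^sub>t\<^sub>s\<close> is estimated by the supremum over \<open>\<tau>\<close>. What is left is the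
  continuity of \<open>R\<close> in the spaces \<open>B\<^sub>\<alpha>\<^sub>+\<^sub>\<epsilon>\<close>, since there only each single \<open>r\<^sup>\<tau>\<close> is known to be
  continuous, and joint continuity is known only in \<open>B\<^sub>\<alpha>\<close>. Here a little regularity is traded: \<open>R\<close> is
  bounded in \<open>B\<^sub>\<alpha>\<^sub>+\<^sub>\<epsilon>\<^sub>'\<close> for some \<open>\<epsilon>' > \<epsilon>\<close>, hence \<open>S\<^sub>\<tau>\<^sub>-\<^sub>t R\<^sub>t\<^sub>s - R\<^sub>t\<^sub>s\<close> is of order
  \<open>(\<tau> - t)\<close> to the power \<open>\<epsilon>' - \<epsilon>\<close> in \<open>B\<^sub>\<alpha>\<^sub>+\<^sub>\<epsilon>\<close>, uniformly in \<open>(t, s)\<close>. Near a given point, \<open>R\<close> is thus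
  uniformly close to the continuous map \<open>r\<^sup>\<tau>\<close> for a fixed \<open>\<tau>\<close> slightly later than \<open>t\<close>
  (lemma \<open>cont_incr_if_frozen_cont_incr\<close>).
\<close>

section \<open>Continuity into a normed subspace\<close>

locale normed_subspace =
  fixes V :: "'a::real_vector set" and N :: "'a \<Rightarrow> real"
  assumes norm_on: "norm_on V N"
begin

lemma subspace: "subspace V"
  using norm_on by (simp add: norm_on_def)

lemma zero_mem: "0 \<in> V"
  using subspace by (rule subspace_0)

lemma diff_mem: "x \<in> V \<Longrightarrow> y \<in> V \<Longrightarrow> x - y \<in> V"
  using subspace by (rule subspace_diff)

lemma add_mem: "x \<in> V \<Longrightarrow> y \<in> V \<Longrightarrow> x + y \<in> V"
  using subspace by (rule subspace_add)

lemma scale_mem: "x \<in> V \<Longrightarrow> c *\<^sub>R x \<in> V"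
  using subspace by (rule subspace_scale)

lemma N_nonneg: "x \<in> V \<Longrightarrow> 0 \<le> N x"
  using norm_on by (simp add: norm_on_def)

lemma N_eq_0: "x \<in> V \<Longrightarrow> N x = 0 \<longleftrightarrow> x = 0"
  using norm_on by (simp add: norm_on_def)

lemma N_zero: "N 0 = 0"
  using N_eq_0 zero_mem by blast

lemma N_scale: "x \<in> V \<Longrightarrow> N (c *\<^sub>R x) = \<bar>c\<bar> * N x"
  using norm_on by (simp add: norm_on_def)

lemma N_add: "x \<in> V \<Longrightarrow> y \<in> V \<Longrightarrow> N (x + y) \<le> N x + N y"
  using norm_on by (simp add: norm_on_def)

lemma N_commute: "x \<in> V \<Longrightarrow> y \<in> V \<Longrightarrow> N (x - y) = N (y - x)"
  using N_scale[of "x - y" "-1"] diff_mem by simp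

lemma N_triangle: "x \<in> V \<Longrightarrow> y \<in> V \<Longrightarrow> z \<in> V \<Longrightarrow> N (x - z) \<le> N (x - y) + N (y - z)"
  using N_add[of "x - y" "y - z"] diff_mem by simp

lemma N_le_add_diff: "x \<in> V \<Longrightarrow> y \<in> V \<Longrightarrow> N x \<le> N y + N (x - y)"
  using N_add[of "y" "x - y"] diff_mem by simp

sublocale Metric_space V "norm_dist V N"
proof
  fix x y z
  show "0 \<le> norm_dist V N x y"
    by (simp add: norm_dist_def N_nonneg diff_mem)
  show "norm_dist V N x y = norm_dist V N y x"
    by (simp add: norm_dist_def N_commute)
  show "norm_dist V N x y = 0 \<longleftrightarrow> x = y" if "x \<in> V" "y \<in> V"
    using that by (simp add: norm_dist_def N_eq_0 diff_mem)
  show "norm_dist V N x z \<le> norm_dist V N x y + norm_dist V N y z"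
    if "x \<in> V" "y \<in> V" "z \<in> V"
    using that by (simp add: norm_dist_def N_triangle)
qed

lemma topspace_norm_topology: "topspace (norm_topology V N) = V"
  by (simp add: norm_topology_def)

lemma mball_iff: "y \<in> mball x e \<longleftrightarrow> x \<in> V \<and> y \<in> V \<and> N (y - x) < e"
  by (auto simp: norm_dist_def N_commute)

text \<open>
  This brings continuity for the topology of a carrier set into the filter calculus, where sums and
  majorants of null functions can be used.
\<close>

lemma continuous_map_norm_topology_iff:
  fixes f :: "'b::metric_space \<Rightarrow> 'a"
  shows "continuous_map (top_of_set D) (norm_topology V N) f \<longleftrightarrow>
    (\<forall>x\<in>D. f x \<in> V \<and> ((\<lambda>y. N (f y - f x)) \<longlongrightarrow> 0) (at x within D))"
proof
  assume L: "continuous_map (top_of_set D) (norm_topology V N) f"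
  have V: "f x \<in> V" if "x \<in> D" for x
    using continuous_map_image_subset_topspace[OF L] that by (auto simp: topspace_norm_topology)
  show "\<forall>x\<in>D. f x \<in> V \<and> ((\<lambda>y. N (f y - f x)) \<longlongrightarrow> 0) (at x within D)"
  proof (intro ballI conjI V)
    fix x assume x: "x \<in> D"
    show "((\<lambda>y. N (f y - f x)) \<longlongrightarrow> 0) (at x within D)"
    proof (rule tendstoI)
      fix e :: real assume "e > 0"
      then obtain U where U: "openin (top_of_set D) U" "x \<in> U" "\<forall>y\<in>U. f y \<in> mball (f x) e"
        using L[unfolded norm_topology_def continuous_map_to_metric, rule_format, of x e] x by auto
      then obtain W where W: "open W" "U = D \<inter> W" by (auto simp: openin_open)
      show "\<forall>\<^sub>F y in at x within D. dist (N (f y - f x)) 0 < e"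
        unfolding eventually_at_topological
      proof (intro exI conjI ballI impI)
        show "open W" "x \<in> W" using U W by auto
        fix y assume "y \<in> W" "y \<in> D"
        then have "f y \<in> mball (f x) e" using U W by auto
        then show "dist (N (f y - f x)) 0 < e"
          using N_nonneg[of "f y - f x"] diff_mem unfolding mball_iff by auto
      qed
    qed
  qed
next
  assume R: "\<forall>x\<in>D. f x \<in> V \<and> ((\<lambda>y. N (f y - f x)) \<longlongrightarrow> 0) (at x within D)"
  show "continuous_map (top_of_set D) (norm_topology V N) f"
    unfolding norm_topology_def continuous_map_to_metric
  proof (intro ballI allI impI)
    fix x and e :: real assume x: "x \<in> topspace (top_of_set D)" and e: "e > 0"
    then have xD: "x \<in> D" by simp
    have "\<forall>\<^sub>F y in at x within D. N (f y - f x) < e"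
      using R xD e by (auto simp: order_tendsto_iff)
    then obtain W where W: "open W" "x \<in> W" "\<And>y. y \<in> W \<Longrightarrow> y \<noteq> x \<Longrightarrow> y \<in> D \<Longrightarrow> N (f y - f x) < e"
      unfolding eventually_at_topological by auto
    show "\<exists>U. openin (top_of_set D) U \<and> x \<in> U \<and> (\<forall>y\<in>U. f y \<in> mball (f x) e)"
    proof (intro exI conjI ballI)
      show "openin (top_of_set D) (D \<inter> W)" "x \<in> D \<inter> W" using W xD by auto
      fix y assume "y \<in> D \<inter> W"
      then show "f y \<in> mball (f x) e"
        using W R xD e N_zero unfolding mball_iff by (cases "y = x") auto
    qed
  qed
qed

end

section \<open>Strongly continuous semigroups on a Banach space\<close>

locale banach_semigroup =
  fixes V :: "'a::real_vector set" and N :: "'a \<Rightarrow> real" and S :: "real \<Rightarrow> 'a \<Rightarrow> 'a"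
  assumes banach: "banach_on V N"
    and C0_semigroup: "C0_semigroup_on V N S"
begin

sublocale normed_subspace V N
  using banach by unfold_locales (simp add: banach_on_def)

lemma S_mem: "0 \<le> t \<Longrightarrow> x \<in> V \<Longrightarrow> S t x \<in> V"
  using C0_semigroup by (simp add: C0_semigroup_on_def bounded_operator_on_def)

lemma S_add: "0 \<le> t \<Longrightarrow> x \<in> V \<Longrightarrow> y \<in> V \<Longrightarrow> S t (x + y) = S t x + S t y"
  using C0_semigroup by (simp add: C0_semigroup_on_def bounded_operator_on_def)

lemma S_scale: "0 \<le> t \<Longrightarrow> x \<in> V \<Longrightarrow> S t (c *\<^sub>R x) = c *\<^sub>R S t x"
  using C0_semigroup by (simp add: C0_semigroup_on_def bounded_operator_on_def)

lemma S_diff: "0 \<le> t \<Longrightarrow> x \<in> V \<Longrightarrow> y \<in> V \<Longrightarrow> S t (x - y) = S t x - S t y"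
  using S_add[of t x "(-1) *\<^sub>R y"] S_scale[of t y "-1"] scale_mem[of y "-1"] by simp

lemma S_bounded: "0 \<le> t \<Longrightarrow> \<exists>C. \<forall>x\<in>V. N (S t x) \<le> C * N x"
  using C0_semigroup by (simp add: C0_semigroup_on_def bounded_operator_on_def)

lemma S_0: "x \<in> V \<Longrightarrow> S 0 x = x"
  using C0_semigroup by (simp add: C0_semigroup_on_def)

lemma S_plus: "0 \<le> s \<Longrightarrow> 0 \<le> t \<Longrightarrow> x \<in> V \<Longrightarrow> S (s + t) x = S s (S t x)"
  using C0_semigroup by (simp add: C0_semigroup_on_def)

lemma S_orbit:
  "x \<in> V \<Longrightarrow> continuous_map (top_of_set {0..}) (norm_topology V N) (\<lambda>t. S t x)"
  using C0_semigroup by (simp add: C0_semigroup_on_def)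

text \<open>
  Banach-Steinhaus for the operators \<open>S t\<close>, \<open>t \<in> {0..T}\<close>: each orbit is continuous and hence bounded
  on \<open>{0..T}\<close>, so \<open>V\<close> is the union of the closed sets \<open>A k\<close> of points whose orbit is bounded by \<open>k\<close>. By
  Baire, some \<open>A k\<close> contains a ball, and scaling a vector into that ball gives the bound.
\<close>

lemma uniformly_bounded_on_compact_times:
  "\<exists>M>0. \<forall>t\<in>{0..T}. \<forall>x\<in>V. N (S t x) \<le> M * N x"
proof -
  have orbit_bdd: "\<exists>k::nat. \<forall>t\<in>{0..T}. N (S t x) \<le> real k" if x: "x \<in> V" for x
  proof -
    have "continuous_on {0..T} (\<lambda>t. N (S t x))"
      unfolding continuous_on_def
    proof
      fix t assume t: "t \<in> {0..T}"
      have "((\<lambda>u. N (S u x - S t x)) \<longlongrightarrow> 0) (at t within {0..})"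
        using S_orbit[OF x] t unfolding continuous_map_norm_topology_iff by auto
      then have lim: "((\<lambda>u. N (S u x - S t x)) \<longlongrightarrow> 0) (at t within {0..T})"
        by (rule tendsto_within_subset) auto
      have "\<forall>\<^sub>F u in at t within {0..T}. norm (N (S u x) - N (S t x)) \<le> N (S u x - S t x)"
        unfolding eventually_at_filter
      proof (intro always_eventually allI impI)
        fix u assume "u \<in> {0..T}"
        then have V: "S u x \<in> V" "S t x \<in> V" using S_mem x t by auto
        show "norm (N (S u x) - N (S t x)) \<le> N (S u x - S t x)"
          using N_le_add_diff[OF V] N_le_add_diff[OF V(2,1)] N_commute[OF V] by auto
      qed
      from Lim_null_comparison[OF this lim]
      show "((\<lambda>u. N (S u x)) \<longlongrightarrow> N (S t x)) (at t within {0..T})"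
        by (simp add: LIM_zero_iff)
    qed
    then have "bounded ((\<lambda>t. N (S t x)) ` {0..T})"
      by (intro compact_imp_bounded compact_continuous_image) auto
    then obtain b where "\<forall>t\<in>{0..T}. \<bar>N (S t x)\<bar> \<le> b" by (auto simp: bounded_iff)
    moreover obtain k :: nat where "b \<le> real k" using real_arch_simple by blast
    ultimately show ?thesis by (meson abs_le_D1 order_trans)
  qed
  define A where "A k = {x\<in>V. \<forall>t\<in>{0..T}. N (S t x) \<le> real k}" for k :: nat
  have closed: "closedin mtopology (A k)" for k
    unfolding closedin_metric
  proof (intro conjI allI impI)
    show "A k \<subseteq> V" by (auto simp: A_def)
    fix x assume "x \<in> V - A k"
    then obtain t where x: "x \<in> V" and t: "t \<in> {0..T}" "N (S t x) > real k"
      by (auto simp: A_def not_le)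
    obtain C where C: "\<And>y. y \<in> V \<Longrightarrow> N (S t y) \<le> C * N y" using S_bounded[of t] t by auto
    define r where "r = (N (S t x) - real k) / (\<bar>C\<bar> + 1)"
    have r: "r > 0" using t by (simp add: r_def)
    moreover have "disjnt (A k) (mball x r)"
      unfolding disjnt_iff
    proof (intro allI notI)
      fix y assume y: "y \<in> A k \<and> y \<in> mball x r"
      then have yV: "y \<in> V" and yr: "N (y - x) < r" unfolding mball_iff by auto
      have xy: "x - y \<in> V" using x yV diff_mem by auto
      have "N (S t x) \<le> N (S t y) + N (S t (x - y))"
        using N_add[of "S t y" "S t (x - y)"] S_add[of t y "x - y"] t yV xy S_mem by auto
      also have "\<dots> \<le> real k + C * N (x - y)"
        using y t C[OF xy] by (auto simp: A_def intro!: add_mono)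
      also have "C * N (x - y) \<le> (\<bar>C\<bar> + 1) * N (x - y)"
        using N_nonneg[OF xy] by (intro mult_right_mono) auto
      also have "(\<bar>C\<bar> + 1) * N (x - y) < (\<bar>C\<bar> + 1) * r"
        using yr N_commute[OF x yV] by (intro mult_strict_left_mono) auto
      also have "real k + (\<bar>C\<bar> + 1) * r = N (S t x)"
        unfolding r_def using abs_ge_zero[of C] by (simp add: field_simps)
      finally show False by simp
    qed
    ultimately show "\<exists>r>0. disjnt (A k) (mball x r)" by blast
  qed
  have "\<exists>k. mtopology interior_of (A k) \<noteq> {}"
  proof (rule ccontr)
    assume "\<nexists>k. mtopology interior_of (A k) \<noteq> {}"
    then have "mtopology interior_of \<Union>(range A) = {}"
      using banach closed by (intro metric_Baire_category_alt) (auto simp: banach_on_def)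
    moreover have "\<Union>(range A) = V" using orbit_bdd by (auto simp: A_def)
    ultimately show False using zero_mem interior_of_topspace[of mtopology] by simp
  qed
  then obtain k x0 where x0_int: "x0 \<in> mtopology interior_of (A k)" by auto
  then obtain e where e: "e > 0" "mball x0 e \<subseteq> A k"
  proof -
    from x0_int obtain e where "e > 0" "mball x0 e \<subseteq> mtopology interior_of (A k)"
      using openin_interior_of[of mtopology "A k"] unfolding openin_mtopology by blast
    with interior_of_subset[of mtopology "A k"] show ?thesis using that by blast
  qed
  have x0: "x0 \<in> V"
    using x0_int interior_of_subset_topspace[of mtopology "A k"] by auto
  show ?thesis
  proof (intro exI[of _ "4 * (real k + 1) / e"] conjI ballI)
    show "0 < 4 * (real k + 1) / e" using e by simp
    fix t x assume t: "t \<in> {0..T}" and x: "x \<in> V"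
    show "N (S t x) \<le> 4 * (real k + 1) / e * N x"
    proof (cases "x = 0")
      case True
      then show ?thesis using S_scale[of t x 0] t x by (simp add: N_zero)
    next
      case False
      then have Nx: "N x > 0" using N_nonneg[OF x] N_eq_0[OF x] by simp
      (* Every x is a multiple of the difference of x0 and a point x0 + c x of the ball; the length
         e / 2 of c x keeps this point strictly inside. *)
      define c where "c = e / 2 / N x"
      have c: "c > 0" "c * N x = e / 2" using e Nx by (simp_all add: c_def)
      have cx: "c *\<^sub>R x \<in> V" using x by (rule scale_mem)
      have "x0 \<in> mball x0 e" using x0 e N_zero unfolding mball_iff by simp
      then have 1: "N (S t x0) \<le> real k" using e t by (auto simp: A_def)
      have "x0 + c *\<^sub>R x \<in> mball x0 e"
        using x0 cx add_mem c e N_scale[OF x, of c] unfolding mball_iff by simp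
      then have 2: "N (S t (x0 + c *\<^sub>R x)) \<le> real k" using e t by (auto simp: A_def)
      have V: "S t x0 \<in> V" "S t (x0 + c *\<^sub>R x) \<in> V" using S_mem t x0 cx add_mem by auto
      have "c * N (S t x) = N (S t (x0 + c *\<^sub>R x) - S t x0)"
        using t x x0 cx c S_mem by (simp add: S_add S_scale N_scale)
      also have "\<dots> \<le> N (S t (x0 + c *\<^sub>R x)) + N (S t x0)"
        using N_triangle[OF V(2) zero_mem V(1)] N_commute[OF zero_mem V(1)] by simp
      also have "\<dots> \<le> 2 * (real k + 1)" using 1 2 by simp
      finally have "N (S t x) \<le> 2 * (real k + 1) / c" using c by (simp add: field_simps)
      also have "\<dots> = 4 * (real k + 1) / e * N x" using e Nx by (simp add: c_def)
      finally show ?thesis .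
    qed
  qed
qed

end

section \<open>Increments as functions on the triangle\<close>

lemma simplex_times_2_iff:
  "ts \<in> simplex_times 2 \<tau> \<longleftrightarrow> (\<exists>t s. ts = [t, s] \<and> 0 \<le> s \<and> s \<le> t \<and> t \<le> \<tau>)"
  by (auto simp: simplex_times_def length_Suc_conv numeral_2_eq_2)

lemma simplex_times_3_iff:
  "ts \<in> simplex_times 3 \<tau> \<longleftrightarrow>
     (\<exists>t u s. ts = [t, u, s] \<and> 0 \<le> s \<and> s \<le> u \<and> u \<le> t \<and> t \<le> \<tau>)"
  by (auto simp: simplex_times_def length_Suc_conv numeral_3_eq_3)

definition triangle :: "real \<Rightarrow> (real \<times> real) set" where
  "triangle \<tau> = {(t, s). 0 \<le> s \<and> s \<le> t \<and> t \<le> \<tau>}"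

lemma topspace_simplex_topology: "topspace (simplex_topology n \<tau>) = simplex_times n \<tau>"
  by (auto simp: simplex_topology_def topspace_pullback_topology topspace_Euclidean_space)

lemma continuous_map_triangle_to_simplex:
  "continuous_map (top_of_set (triangle \<tau>)) (simplex_topology 2 \<tau>) (\<lambda>(t, s). [t, s])"
  unfolding simplex_topology_def
proof (rule continuous_map_pullback')
  have "continuous_map (top_of_set (triangle \<tau>)) euclideanreal (\<lambda>p. (case p of (t, s) \<Rightarrow> [t, s]) ! i)"
    if "i < 2" for i
  proof -
    have "continuous_on (triangle \<tau>) (\<lambda>p. (case p of (t, s) \<Rightarrow> [t, s]) ! i)"
    proof (cases "i = 0")
      case True
      then show ?thesis by (simp add: case_prod_unfold continuous_on_fst)
    next
      case False
      then have "i = 1" using that by simp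
      then show ?thesis by (simp add: case_prod_unfold continuous_on_snd)
    qed
    then show ?thesis by simp
  qed
  then show "continuous_map (top_of_set (triangle \<tau>)) (Euclidean_space 2)
      ((\<lambda>ts i. if i < 2 then ts ! i else 0) \<circ> (\<lambda>(t, s). [t, s]))"
    unfolding o_def continuous_map_componentwise_Euclidean_space by simp
  show "topspace (top_of_set (triangle \<tau>)) \<subseteq> (\<lambda>(t, s). [t, s]) -` simplex_times 2 \<tau>"
    by (auto simp: simplex_times_2_iff triangle_def)
qed

lemma continuous_map_simplex_to_triangle:
  "continuous_map (simplex_topology 2 \<tau>) (top_of_set (triangle \<tau>)) (\<lambda>ts. (ts ! 0, ts ! 1))"
proof -
  have coord: "continuous_map (simplex_topology 2 \<tau>) euclideanreal (\<lambda>ts. ts ! i)" if "i < 2" for i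
  proof -
    have "continuous_map (Euclidean_space 2) euclideanreal (\<lambda>x. x i)"
      unfolding Euclidean_space_def
      by (intro continuous_map_from_subtopology continuous_map_product_projection) simp
    then have "continuous_map (simplex_topology 2 \<tau>) euclideanreal
        ((\<lambda>x. x i) \<circ> (\<lambda>ts i. if i < 2 then ts ! i else 0))"
      unfolding simplex_topology_def by (rule continuous_map_pullback)
    then show ?thesis using that by (simp add: o_def)
  qed
  have "continuous_map (simplex_topology 2 \<tau>) (prod_topology euclideanreal euclideanreal)
      (\<lambda>ts. (ts ! 0, ts ! 1))"
    using coord[of 0] coord[of 1] unfolding continuous_map_pairwise o_def by simp
  then show ?thesis
    by (auto simp: continuous_map_in_subtopology topspace_simplex_topology simplex_times_2_iff
        triangle_def)
qed

text \<open>
  The lists \<open>[t, s]\<close> with the simplex topology form a homeomorphic copy of the triangle, so continuity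
  of an increment can be checked with the filters of \<^typ>\<open>real \<times> real\<close>.
\<close>

lemma cont_incr_2_iff:
  "g \<in> cont_incr 2 \<tau> V N \<longleftrightarrow> g \<in> extensional (simplex_times 2 \<tau>) \<and>
     continuous_map (top_of_set (triangle \<tau>)) (norm_topology V N) (\<lambda>(t, s). g [t, s])"
proof -
  have "continuous_map (simplex_topology 2 \<tau>) X g" 
    if "continuous_map (top_of_set (triangle \<tau>)) X (\<lambda>(t, s). g [t, s])" for X :: "'a topology"
  proof (rule continuous_map_eq)
    show "continuous_map (simplex_topology 2 \<tau>) X ((\<lambda>(t, s). g [t, s]) \<circ> (\<lambda>ts. (ts ! 0, ts ! 1)))"
      by (rule continuous_map_compose[OF continuous_map_simplex_to_triangle that])
  qed (auto simp: topspace_simplex_topology simplex_times_2_iff)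
  moreover have "continuous_map (top_of_set (triangle \<tau>)) X (\<lambda>(t, s). g [t, s])"
    if "continuous_map (simplex_topology 2 \<tau>) X g" for X :: "'a topology"
    using continuous_map_compose[OF continuous_map_triangle_to_simplex that]
    by (simp add: o_def case_prod_unfold)
  ultimately show ?thesis unfolding cont_incr_def by blast
qed

lemma delta_2: 
  assumes "0 \<le> s" "s \<le> u" "u \<le> t" "t \<le> \<tau>"
  shows "delta 2 \<tau> g [t, u, s] = g [t, s] - g [t, u] - g [u, s]"
proof -
  have "[t, u, s] \<in> simplex_times 3 \<tau>" using assms by (simp add: simplex_times_3_iff)
  moreover have "{1..3::nat} = {1, 2, 3}" by auto
  ultimately show ?thesis by (simp add: delta_def)
qed

lemma delta_hat_2:
  assumes "0 \<le> s" "s \<le> u" "u \<le> t" "t \<le> \<tau>"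
  shows "delta_hat S 2 \<tau> g [t, u, s] = g [t, s] - g [t, u] - S (t - u) (g [u, s])"
proof -
  have "[t, u, s] \<in> simplex_times 3 \<tau>" using assms by (simp add: simplex_times_3_iff)
  then show ?thesis by (simp add: delta_hat_def delta_2[OF assms])
qed

section \<open>Freezing and unfreezing\<close>

lemma cont_incr_memD: "g \<in> cont_incr n \<tau> V N \<Longrightarrow> norm_on V N \<Longrightarrow> ts \<in> simplex_times n \<tau> \<Longrightarrow> g ts \<in> V"
  using continuous_map_image_subset_topspace[of "simplex_topology n \<tau>" "norm_topology V N" g]
  by (auto simp: cont_incr_def topspace_simplex_topology normed_subspace.topspace_norm_topology
      normed_subspace.intro)

lemma cont_incr_extensional: "g \<in> cont_incr n \<tau> V N \<Longrightarrow> g \<in> extensional (simplex_times n \<tau>)"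
  by (simp add: cont_incr_def)

lemma Theta_2: "0 \<le> s \<Longrightarrow> s \<le> t \<Longrightarrow> t \<le> \<tau> \<Longrightarrow> Theta S 2 \<tau> g [t, s] = S (\<tau> - t) (g [t, s])"
  by (simp add: Theta_def simplex_times_2_iff)

lemma Theta_3:
  "0 \<le> s \<Longrightarrow> s \<le> u \<Longrightarrow> u \<le> t \<Longrightarrow> t \<le> \<tau> \<Longrightarrow> Theta S 3 \<tau> g [t, u, s] = S (\<tau> - t) (g [t, u, s])"
  by (simp add: Theta_def simplex_times_3_iff)

lemma unfreeze_2: "0 \<le> s \<Longrightarrow> s \<le> t \<Longrightarrow> t \<le> T \<Longrightarrow> unfreeze T r [t, s] = r t [t, s]"
  by (simp add: unfreeze_def simplex_times_2_iff)

context banach_semigroup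
begin

lemma cont_incr_mem: "g \<in> cont_incr n \<tau> V N \<Longrightarrow> ts \<in> simplex_times n \<tau> \<Longrightarrow> g ts \<in> V"
  using cont_incr_memD norm_on by blast

lemma cont_incr_2_mem:
  "g \<in> cont_incr 2 \<tau> V N \<Longrightarrow> 0 \<le> s \<Longrightarrow> s \<le> t \<Longrightarrow> t \<le> \<tau> \<Longrightarrow> g [t, s] \<in> V"
  by (rule cont_incr_mem) (auto simp: simplex_times_2_iff)

text \<open>
  The product of the strongly continuous \<open>t \<mapsto> S t\<close> with a continuous \<open>f\<close> is continuous because
  \<open>S (a y) (f y) - S (a x) (f x)\<close> splits into \<open>S (a y) (f y - f x)\<close>, small by uniform boundedness, and
  an increment of the orbit of the fixed vector \<open>f x\<close>.
\<close>

lemma continuous_map_semigroup_action: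
  fixes f :: "'b::metric_space \<Rightarrow> 'a"
  assumes f: "continuous_map (top_of_set D) (norm_topology V N) f"
    and a: "continuous_on D a" "a ` D \<subseteq> {0..T}"
  shows "continuous_map (top_of_set D) (norm_topology V N) (\<lambda>y. S (a y) (f y))"
  unfolding continuous_map_norm_topology_iff
proof (intro ballI conjI)
  fix x assume x: "x \<in> D"
  have fV: "f y \<in> V" if "y \<in> D" for y
    using f that unfolding continuous_map_norm_topology_iff by blast
  have a0: "0 \<le> a y" if "y \<in> D" for y using a(2) that by force
  show "S (a x) (f x) \<in> V" using S_mem[OF a0 fV] x by blast
  obtain M where M: "\<And>t y. t \<in> {0..T} \<Longrightarrow> y \<in> V \<Longrightarrow> N (S t y) \<le> M * N y"
    using uniformly_bounded_on_compact_times by metis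
  have "continuous_map (top_of_set D) (norm_topology V N) ((\<lambda>t. S t (f x)) \<circ> a)"
    using a a0 by (intro continuous_map_compose[OF _ S_orbit[OF fV[OF x]]]) auto
  then have orbit: "((\<lambda>y. N (S (a y) (f x) - S (a x) (f x))) \<longlongrightarrow> 0) (at x within D)"
    using x unfolding continuous_map_norm_topology_iff by (auto simp: o_def)
  have "((\<lambda>y. N (f y - f x)) \<longlongrightarrow> 0) (at x within D)"
    using f x unfolding continuous_map_norm_topology_iff by blast
  from tendsto_add[OF tendsto_mult_left[OF this, of M] orbit]
  have lim: "((\<lambda>y. M * N (f y - f x) + N (S (a y) (f x) - S (a x) (f x))) \<longlongrightarrow> 0) (at x within D)"
    by simp
  show "((\<lambda>y. N (S (a y) (f y) - S (a x) (f x))) \<longlongrightarrow> 0) (at x within D)"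
  proof (rule Lim_null_comparison[OF _ lim], unfold eventually_at_filter,
      intro always_eventually allI impI)
    fix y assume y: "y \<in> D"
    have V: "S (a y) (f y) \<in> V" "S (a y) (f x) \<in> V" "S (a x) (f x) \<in> V"
      using S_mem a0 fV x y by auto
    have "N (S (a y) (f y) - S (a x) (f x))
        \<le> N (S (a y) (f y) - S (a y) (f x)) + N (S (a y) (f x) - S (a x) (f x))"
      using N_triangle V by blast
    also have "S (a y) (f y) - S (a y) (f x) = S (a y) (f y - f x)"
      using S_diff a0 fV x y by simp
    also have "N (S (a y) (f y - f x)) \<le> M * N (f y - f x)"
      using M a(2) y x fV diff_mem by (auto simp: image_subset_iff)
    finally show "norm (N (S (a y) (f y) - S (a x) (f x)))
        \<le> M * N (f y - f x) + N (S (a y) (f x) - S (a x) (f x))"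
      using N_nonneg diff_mem V by simp
  qed
qed

lemma continuous_map_Theta:
  assumes R: "R \<in> cont_incr 2 T V N"
  shows "continuous_map (top_of_set {(\<tau>, t, s). 0 \<le> s \<and> s \<le> t \<and> t \<le> \<tau> \<and> \<tau> \<le> T})
    (norm_topology V N) (\<lambda>(\<tau>, t, s). Theta S 2 \<tau> R [t, s])"
proof -
  let ?D = "{(\<tau>, t, s). 0 \<le> s \<and> s \<le> t \<and> t \<le> \<tau> \<and> \<tau> \<le> T} :: (real \<times> real \<times> real) set"
  have "continuous_map (top_of_set ?D) (top_of_set (triangle T)) snd"
    by (auto simp: triangle_def intro!: continuous_on_snd)
  moreover have "continuous_map (top_of_set (triangle T)) (norm_topology V N) (\<lambda>(t, s). R [t, s])"
    using R by (simp add: cont_incr_2_iff)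
  ultimately have "continuous_map (top_of_set ?D) (norm_topology V N) ((\<lambda>(t, s). R [t, s]) \<circ> snd)"
    by (rule continuous_map_compose)
  then have "continuous_map (top_of_set ?D) (norm_topology V N)
      (\<lambda>y. S (fst y - fst (snd y)) (((\<lambda>(t, s). R [t, s]) \<circ> snd) y))"
    by (rule continuous_map_semigroup_action[where T = T]) (auto intro!: continuous_intros)
  then show ?thesis
    by (rule continuous_map_eq) (auto simp: Theta_2)
qed

lemma Theta_cont_incr:
  assumes R: "R \<in> cont_incr 2 T V N" and "\<tau> \<le> T"
  shows "Theta S 2 \<tau> R \<in> cont_incr 2 \<tau> V N"
proof -
  have "continuous_map (top_of_set (triangle \<tau>))
      (top_of_set {(\<tau>, t, s). 0 \<le> s \<and> s \<le> t \<and> t \<le> \<tau> \<and> \<tau> \<le> T}) (\<lambda>p. (\<tau>, p))"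
    using \<open>\<tau> \<le> T\<close> by (auto simp: triangle_def intro!: continuous_intros)
  from continuous_map_compose[OF this continuous_map_Theta[OF R]]
  have "continuous_map (top_of_set (triangle \<tau>)) (norm_topology V N)
      (\<lambda>(t, s). Theta S 2 \<tau> R [t, s])"
    by (simp add: o_def case_prod_unfold)
  then show ?thesis by (simp add: cont_incr_2_iff Theta_def)
qed

text \<open>
  Freezing intertwines \<^const>\<open>delta\<close> and \<^const>\<open>delta_hat\<close>: the exponent \<open>\<tau> - u\<close> splits as
  \<open>(\<tau> - t) + (t - u)\<close>, and then \<open>S (\<tau> - t)\<close> is common to all terms.
\<close>

lemma delta_Theta:
  assumes R: "R \<in> cont_incr 2 T V N" and \<tau>: "\<tau> \<le> T"
  shows "delta 2 \<tau> (Theta S 2 \<tau> R) = Theta S 3 \<tau> (delta_hat S 2 T R)"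
proof (rule extensionalityI[of _ "simplex_times 3 \<tau>"])
  fix ts assume "ts \<in> simplex_times 3 \<tau>"
  then obtain t u s where ts: "ts = [t, u, s]" and o: "0 \<le> s" "s \<le> u" "u \<le> t" "t \<le> \<tau>"
    by (auto simp: simplex_times_3_iff)
  have V: "R [t, s] \<in> V" "R [t, u] \<in> V" "R [u, s] \<in> V"
    using o \<tau> by (auto intro!: cont_incr_2_mem[OF R])
  have "delta 2 \<tau> (Theta S 2 \<tau> R) ts
      = S (\<tau> - t) (R [t, s]) - S (\<tau> - t) (R [t, u]) - S ((\<tau> - t) + (t - u)) (R [u, s])"
    using o by (simp add: ts delta_2 Theta_2)
  also have "\<dots> = S (\<tau> - t) (R [t, s] - R [t, u] - S (t - u) (R [u, s]))"
    using o V by (subst S_plus) (auto simp: S_diff S_mem diff_mem)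
  also have "\<dots> = Theta S 3 \<tau> (delta_hat S 2 T R) ts"
    using o \<tau> by (simp add: ts Theta_3 delta_hat_2)
  finally show "delta 2 \<tau> (Theta S 2 \<tau> R) ts = Theta S 3 \<tau> (delta_hat S 2 T R) ts" .
qed (simp_all add: delta_def Theta_def)

lemma frozen_map_in_frozen_families:
  assumes R: "R \<in> cont_incr 2 T V N"
  shows "frozen_map S T R \<in> frozen_families S T V N (delta_hat S 2 T R)"
proof -
  let ?D = "{(\<tau>, t, s). 0 \<le> s \<and> s \<le> t \<and> t \<le> \<tau> \<and> \<tau> \<le> T} :: (real \<times> real \<times> real) set"
  have "continuous_map (top_of_set ?D) (norm_topology V N) (\<lambda>(\<tau>, t, s). frozen_map S T R \<tau> [t, s])"
    by (rule continuous_map_eq[OF continuous_map_Theta[OF R]]) (auto simp: frozen_map_def)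
  moreover have "frozen_map S T R \<tau> [t, s] = S (\<tau> - \<tau>') (frozen_map S T R \<tau>' [t, s])"
    if o: "0 \<le> s" "s \<le> t" "t \<le> \<tau>'" "\<tau>' \<le> \<tau>" "\<tau> \<le> T" for s t \<tau>' \<tau>
    using o S_plus[of "\<tau> - \<tau>'" "\<tau>' - t" "R [t, s]"] cont_incr_2_mem[OF R, of s t]
    by (simp add: frozen_map_def Theta_2)
  ultimately show ?thesis
    using R by (simp add: frozen_families_def Theta_cont_incr delta_Theta)
      (simp add: frozen_map_def Theta_cont_incr delta_Theta)
qed

lemma unfreeze_frozen_map:
  assumes R: "R \<in> cont_incr 2 T V N"
  shows "unfreeze T (frozen_map S T R) = R"
proof (rule extensionalityI[of _ "simplex_times 2 T"])
  fix ts assume "ts \<in> simplex_times 2 T"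
  then obtain t s where ts: "ts = [t, s]" and o: "0 \<le> s" "s \<le> t" "t \<le> T"
    by (auto simp: simplex_times_2_iff)
  then show "unfreeze T (frozen_map S T R) ts = R ts"
    by (simp add: unfreeze_2 frozen_map_def Theta_2 S_0 cont_incr_2_mem[OF R])
qed (simp_all add: unfreeze_def cont_incr_extensional[OF R])

lemma frozen_map_unfreeze:
  assumes r: "r \<in> frozen_families S T V N h"
  shows "frozen_map S T (unfreeze T r) = r"
proof (rule extensionalityI[of _ "{0..T}"])
  fix \<tau> assume \<tau>: "\<tau> \<in> {0..T}"
  have "Theta S 2 \<tau> (unfreeze T r) = r \<tau>"
  proof (rule extensionalityI[of _ "simplex_times 2 \<tau>"])
    fix ts assume "ts \<in> simplex_times 2 \<tau>"
    then obtain t s where ts: "ts = [t, s]" and o: "0 \<le> s" "s \<le> t" "t \<le> \<tau>"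
      by (auto simp: simplex_times_2_iff)
    have "r \<tau> [t, s] = S (\<tau> - t) (r t [t, s])"
      using r o \<tau> by (auto simp: frozen_families_def)
    then show "Theta S 2 \<tau> (unfreeze T r) ts = r \<tau> ts"
      using o \<tau> by (simp add: ts Theta_2 unfreeze_2)
  next
    have "r \<tau> \<in> cont_incr 2 \<tau> V N" using r \<tau> by (simp add: frozen_families_def)
    then show "r \<tau> \<in> extensional (simplex_times 2 \<tau>)" by (rule cont_incr_extensional)
  qed (simp add: Theta_def)
  then show "frozen_map S T (unfreeze T r) \<tau> = r \<tau>" using \<tau> by (simp add: frozen_map_def)
qed (use r in \<open>auto simp: frozen_map_def frozen_families_def\<close>)

lemma unfreeze_cont_incr:
  assumes r: "r \<in> frozen_families S T V N h"
  shows "unfreeze T r \<in> cont_incr 2 T V N"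
proof -
  have "continuous_map (top_of_set (triangle T))
      (top_of_set {(\<tau>, t, s). 0 \<le> s \<and> s \<le> t \<and> t \<le> \<tau> \<and> \<tau> \<le> T}) (\<lambda>p. (fst p, p))"
    by (auto simp: triangle_def intro!: continuous_intros)
  moreover have "continuous_map (top_of_set {(\<tau>, t, s). 0 \<le> s \<and> s \<le> t \<and> t \<le> \<tau> \<and> \<tau> \<le> T})
      (norm_topology V N) (\<lambda>(\<tau>, t, s). r \<tau> [t, s])"
    using r by (simp add: frozen_families_def)
  ultimately have "continuous_map (top_of_set (triangle T)) (norm_topology V N)
      ((\<lambda>(\<tau>, t, s). r \<tau> [t, s]) \<circ> (\<lambda>p. (fst p, p)))"
    by (rule continuous_map_compose)
  then have "continuous_map (top_of_set (triangle T)) (norm_topology V N)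
      (\<lambda>(t, s). unfreeze T r [t, s])"
    by (rule continuous_map_eq) (auto simp: unfreeze_2 triangle_def)
  then show ?thesis by (simp add: cont_incr_2_iff unfreeze_def)
qed

text \<open>
  By compatibility, the twisted term \<open>S (t - u)\<close> applied to the increment over \<open>[u, s]\<close> is the value
  of \<open>r t\<close> at \<open>[u, s]\<close>. So the left-hand side at \<open>[t, u, s]\<close> is the ordinary \<^const>\<open>delta\<close> of the
  single increment \<open>r t\<close>.
\<close>

lemma delta_hat_unfreeze:
  assumes r: "r \<in> frozen_families S T V N h" and h: "h \<in> cont_incr 3 T V N"
  shows "delta_hat S 2 T (unfreeze T r) = h"
proof (rule extensionalityI[of _ "simplex_times 3 T"])
  fix ts assume mem: "ts \<in> simplex_times 3 T"
  then obtain t u s where ts: "ts = [t, u, s]" and o: "0 \<le> s" "s \<le> u" "u \<le> t" "t \<le> T"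
    by (auto simp: simplex_times_3_iff)
  have "r t [u, s] = S (t - u) (r u [u, s])"
    using r o by (auto simp: frozen_families_def)
  then have "delta_hat S 2 T (unfreeze T r) ts = delta 2 t (r t) ts"
    using o by (simp add: ts delta_hat_2 delta_2 unfreeze_2)
  also have "\<dots> = Theta S 3 t h ts"
    using r o by (simp add: frozen_families_def)
  also have "\<dots> = h ts"
    using o S_0[OF cont_incr_mem[OF h mem]] by (simp add: ts Theta_3)
  finally show "delta_hat S 2 T (unfreeze T r) ts = h ts" .
qed (simp_all add: delta_hat_def cont_incr_extensional[OF h])

lemma bij_betw_frozen_map:
  assumes h: "h \<in> cont_incr 3 T V N"
  shows "bij_betw (frozen_map S T) {R \<in> cont_incr 2 T V N. delta_hat S 2 T R = h}
    (frozen_families S T V N h)"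
  by (rule bij_betw_byWitness[where f' = "unfreeze T"])
    (use frozen_map_in_frozen_families unfreeze_cont_incr delta_hat_unfreeze[OF _ h] in
      \<open>auto simp: unfreeze_frozen_map frozen_map_unfreeze\<close>)

end

section \<open>Weighted norms of frozen increments\<close>

text \<open>
  The common form of the Hoelder norms, with weight \<open>w x = x powr \<mu>\<close>, and of the logarithmic norm.
\<close>

definition incr_norm ::
    "(real \<Rightarrow> real) \<Rightarrow> real \<Rightarrow> ('a \<Rightarrow> real) \<Rightarrow> (real list \<Rightarrow> 'a) \<Rightarrow> ennreal" where
  "incr_norm w \<tau> N g =
     (SUP (t, s)\<in>{(t, s). 0 \<le> s \<and> s < t \<and> t \<le> \<tau>}. ennreal (N (g [t, s]) / w \<bar>t - s\<bar>))"

lemma holder_norm_eq_incr_norm: "holder_norm \<tau> N \<mu> = incr_norm (\<lambda>x. x powr \<mu>) \<tau> N"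
  by (simp add: fun_eq_iff holder_norm_def incr_norm_def)

lemma log_norm_eq_incr_norm: "log_norm \<tau> N = incr_norm (\<lambda>x. x * (1 + \<bar>ln x\<bar>)) \<tau> N"
  by (simp add: fun_eq_iff log_norm_def incr_norm_def)

lemma incr_norm_finiteE:
  assumes fin: "incr_norm w \<tau> N g < \<infinity>" and w: "\<And>x. 0 < x \<Longrightarrow> 0 < w x"
  obtains C where "0 \<le> C" "\<And>t s. 0 \<le> s \<Longrightarrow> s < t \<Longrightarrow> t \<le> \<tau> \<Longrightarrow> N (g [t, s]) \<le> C * w (t - s)"
proof
  show "0 \<le> enn2real (incr_norm w \<tau> N g)" by simp
  fix t s :: real assume o: "0 \<le> s" "s < t" "t \<le> \<tau>"
  have "ennreal (N (g [t, s]) / w (t - s)) \<le> incr_norm w \<tau> N g"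
    unfolding incr_norm_def using o by (intro SUP_upper2[of "(t, s)"]) auto
  also have "\<dots> = ennreal (enn2real (incr_norm w \<tau> N g))"
    using fin by simp
  finally have "N (g [t, s]) / w (t - s) \<le> enn2real (incr_norm w \<tau> N g)"
    by (subst (asm) ennreal_le_iff) simp_all
  then show "N (g [t, s]) \<le> enn2real (incr_norm w \<tau> N g) * w (t - s)"
    using w[of "t - s"] o by (simp add: field_simps)
qed

context banach_semigroup
begin

lemma frozen_map_incr_norm_finite:
  assumes R: "R \<in> cont_incr 2 T V N" and w: "\<And>x. 0 \<le> x \<Longrightarrow> 0 \<le> w x"
    and fin: "incr_norm w T N R < \<infinity>"
  shows "(SUP \<tau>\<in>{0..T}. incr_norm w \<tau> N (frozen_map S T R \<tau>)) < \<infinity>"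
    and "\<tau> \<in> {0..T} \<Longrightarrow> frozen_map S T R \<tau> \<in> cont_incr 2 \<tau> V N"
    and "\<tau> \<in> {0..T} \<Longrightarrow> incr_norm w \<tau> N (frozen_map S T R \<tau>) < \<infinity>"
proof -
  obtain M where M0: "M > 0" and M: "\<And>t x. t \<in> {0..T} \<Longrightarrow> x \<in> V \<Longrightarrow> N (S t x) \<le> M * N x"
    using uniformly_bounded_on_compact_times by metis
  have "(SUP \<tau>\<in>{0..T}. incr_norm w \<tau> N (frozen_map S T R \<tau>)) \<le> ennreal M * incr_norm w T N R"
  proof (rule SUP_least)
    fix \<tau> assume \<tau>: "\<tau> \<in> {0..T}"
    show "incr_norm w \<tau> N (frozen_map S T R \<tau>) \<le> ennreal M * incr_norm w T N R"
      unfolding incr_norm_def[of w \<tau>]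
    proof (rule SUP_least, clarify)
      fix t s :: real assume o: "0 \<le> s" "s < t" "t \<le> \<tau>"
      have mem: "R [t, s] \<in> V" using o \<tau> by (auto intro: cont_incr_2_mem[OF R])
      have "N (frozen_map S T R \<tau> [t, s]) \<le> M * N (R [t, s])"
        using o \<tau> M[OF _ mem, of "\<tau> - t"] by (simp add: frozen_map_def Theta_2)
      then have "N (frozen_map S T R \<tau> [t, s]) / w \<bar>t - s\<bar> \<le> M * N (R [t, s]) / w \<bar>t - s\<bar>"
        by (rule divide_right_mono) (simp add: w)
      then have "ennreal (N (frozen_map S T R \<tau> [t, s]) / w \<bar>t - s\<bar>)
          \<le> ennreal (M * (N (R [t, s]) / w \<bar>t - s\<bar>))"
        by (simp add: ennreal_leI)
      also have "\<dots> = ennreal M * ennreal (N (R [t, s]) / w \<bar>t - s\<bar>)"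
        using M0 N_nonneg[OF mem] w[of "\<bar>t - s\<bar>"] by (subst ennreal_mult[symmetric]) auto
      also have "\<dots> \<le> ennreal M * incr_norm w T N R"
        unfolding incr_norm_def using o \<tau>
        by (intro mult_left_mono SUP_upper2[of "(t, s)"]) auto
      finally show "ennreal (N (frozen_map S T R \<tau> [t, s]) / w \<bar>t - s\<bar>)
          \<le> ennreal M * incr_norm w T N R" .
    qed
  qed
  also have "\<dots> < \<infinity>" using fin by (simp add: ennreal_mult_less_top)
  finally show sup: "(SUP \<tau>\<in>{0..T}. incr_norm w \<tau> N (frozen_map S T R \<tau>)) < \<infinity>" .
  show "frozen_map S T R \<tau> \<in> cont_incr 2 \<tau> V N" if "\<tau> \<in> {0..T}"
    using that Theta_cont_incr[OF R] by (simp add: frozen_map_def)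
  show "incr_norm w \<tau> N (frozen_map S T R \<tau>) < \<infinity>" if "\<tau> \<in> {0..T}"
    using SUP_upper[OF that] sup by (rule order.strict_trans1)
qed

end

text \<open>
  The value of \<open>R\<close> at \<open>[t, s]\<close> is that of the increment frozen at time \<open>t\<close>, so it is already seen by
  the norm over the smaller triangle up to \<open>t\<close>.
\<close>

lemma incr_norm_le_SUP_incr_norm_frozen_map:
  assumes "\<And>t s. 0 \<le> s \<Longrightarrow> s \<le> t \<Longrightarrow> t \<le> T \<Longrightarrow> S 0 (R [t, s]) = R [t, s]"
  shows "incr_norm w T N R \<le> (SUP \<tau>\<in>{0..T}. incr_norm w \<tau> N (frozen_map S T R \<tau>))"
  unfolding incr_norm_def[of w T]
proof (rule SUP_least, clarify)
  fix t s :: real assume o: "0 \<le> s" "s < t" "t \<le> T"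
  have "ennreal (N (R [t, s]) / w \<bar>t - s\<bar>) \<le> incr_norm w t N (frozen_map S T R t)"
    unfolding incr_norm_def using o assms[of s t]
    by (intro SUP_upper2[of "(t, s)"]) (auto simp: frozen_map_def Theta_2)
  also have "\<dots> \<le> (SUP \<tau>\<in>{0..T}. incr_norm w \<tau> N (frozen_map S T R \<tau>))"
    using o by (intro SUP_upper) auto
  finally show "ennreal (N (R [t, s]) / w \<bar>t - s\<bar>) \<le> \<dots>" .
qed

context banach_semigroup
begin

text \<open>
  The Hoelder norms only see times \<open>s < t\<close>; the value on the diagonal is recovered by continuity, along
  points at distance \<open>\<eta>\<close> from the diagonal.
\<close>

lemma incr_zero_on_diagonal:
  assumes g: "g \<in> cont_incr 2 T V N" and T: "0 < T" and \<mu>: "0 < \<mu>"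
    and bound: "\<And>t s. 0 \<le> s \<Longrightarrow> s < t \<Longrightarrow> t \<le> T \<Longrightarrow> N (g [t, s]) \<le> C * (t - s) powr \<mu>"
    and t: "0 \<le> t" "t \<le> T"
  shows "g [t, t] = 0"
proof -
  (* The first coordinate is cut off at T, so that the path stays in the triangle at t = T too. *)
  define p where "p \<eta> = (min T (t + \<eta>), min T (t + \<eta>) - \<eta>)" for \<eta>
  have small: "\<forall>\<^sub>F \<eta> in at_right 0. 0 < \<eta> \<and> \<eta> < T"
    using T by (auto simp: eventually_at_right)
  have p_mem: "p \<eta> \<in> triangle T" if "0 < \<eta>" "\<eta> < T" for \<eta>
    using that t by (auto simp: p_def triangle_def min_def)
  have "(p \<longlongrightarrow> (min T (t + 0), min T (t + 0) - 0)) (at_right 0)"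
    unfolding p_def by (intro tendsto_intros)
  moreover have "min T (t + 0) = t" using t by simp
  ultimately have "(p \<longlongrightarrow> (t, t)) (at_right 0)" by simp
  moreover have "\<forall>\<^sub>F \<eta> in at_right 0. p \<eta> \<in> triangle T \<and> p \<eta> \<noteq> (t, t)"
    using small by eventually_elim (use p_mem in \<open>auto simp: p_def\<close>)
  ultimately have p: "filterlim p (at (t, t) within triangle T) (at_right 0)"
    unfolding filterlim_at by blast
  have "(t, t) \<in> triangle T" using t by (simp add: triangle_def)
  then have "((\<lambda>y. N ((\<lambda>(t, s). g [t, s]) y - g [t, t])) \<longlongrightarrow> 0) (at (t, t) within triangle T)"
    using g unfolding cont_incr_2_iff continuous_map_norm_topology_iff by fastforce
  from filterlim_compose[OF this p]
  have 1: "((\<lambda>\<eta>. N ((\<lambda>(t, s). g [t, s]) (p \<eta>) - g [t, t])) \<longlongrightarrow> 0) (at_right 0)" .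
  have "((\<lambda>\<eta>. C * \<eta> powr \<mu>) \<longlongrightarrow> C * 0 powr \<mu>) (at_right 0)"
    using \<mu> by (intro tendsto_mult_left tendsto_powr' tendsto_const tendsto_ident_at)
      (auto simp: eventually_at_right intro!: exI[of _ 1])
  from tendsto_add[OF this 1]
  have lim: "((\<lambda>\<eta>. C * \<eta> powr \<mu> + N ((\<lambda>(t, s). g [t, s]) (p \<eta>) - g [t, t])) \<longlongrightarrow> 0) (at_right 0)"
    by simp
  have gV: "g [t, t] \<in> V" using t by (intro cont_incr_2_mem[OF g]) auto
  have "\<forall>\<^sub>F \<eta> in at_right 0. N (g [t, t]) \<le> C * \<eta> powr \<mu> + N ((\<lambda>(t, s). g [t, s]) (p \<eta>) - g [t, t])"
    using small
  proof eventually_elim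
    case (elim \<eta>)
    obtain t' s' where p': "p \<eta> = (t', s')" by force
    have o: "0 \<le> s'" "s' < t'" "t' \<le> T" "t' - s' = \<eta>"
      using elim t p' by (auto simp: p_def)
    have V: "g [t', s'] \<in> V" using o by (intro cont_incr_2_mem[OF g]) auto
    show ?case
      using N_le_add_diff[OF gV V] N_commute[OF gV V] bound[OF o(1-3)] o(4) by (simp add: p')
  qed
  then have "N (g [t, t]) \<le> 0"
    using lim by (intro tendsto_lowerbound[OF lim]) auto
  then show ?thesis using N_nonneg[OF gV] N_eq_0[OF gV] by simp
qed

end

section \<open>Regularity in the scale\<close>

locale banach_scale_semigroup =
  fixes T :: real and B :: "real \<Rightarrow> 'a::real_vector set" and N :: "real \<Rightarrow> 'a \<Rightarrow> real"
    and S :: "real \<Rightarrow> 'a \<Rightarrow> 'a"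
  assumes T_pos: "0 < T" and scale: "banach_scale B N"
    and semigroup: "analytic_semigroup_on_scale T B N S"
begin

sublocale level: banach_semigroup "B \<beta>" "N \<beta>" S for \<beta>
  using scale semigroup
  by unfold_locales (auto simp: banach_scale_def analytic_semigroup_on_scale_def analytic_semigroup_on_def)

lemma cont_incr_weaker_norm:
  assumes "\<alpha> \<le> \<beta>" and R: "R \<in> cont_incr 2 \<tau> (B \<beta>) (N \<beta>)"
  shows "R \<in> cont_incr 2 \<tau> (B \<alpha>) (N \<alpha>)"
proof -
  obtain C where C: "\<And>x. x \<in> B \<beta> \<Longrightarrow> x \<in> B \<alpha> \<and> N \<alpha> x \<le> C * N \<beta> x"
    using scale \<open>\<alpha> \<le> \<beta>\<close> unfolding banach_scale_def by blast
  let ?f = "\<lambda>(t, s). R [t, s]"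
  have mem: "?f x \<in> B \<beta>" if "x \<in> triangle \<tau>" for x
    using that level.cont_incr_2_mem[OF R] by (auto simp: triangle_def)
  have "continuous_map (top_of_set (triangle \<tau>)) (norm_topology (B \<alpha>) (N \<alpha>)) ?f"
    unfolding level.continuous_map_norm_topology_iff
  proof (intro ballI conjI)
    fix x assume x: "x \<in> triangle \<tau>"
    then show "?f x \<in> B \<alpha>" using mem C by blast
    have "((\<lambda>y. N \<beta> (?f y - ?f x)) \<longlongrightarrow> 0) (at x within triangle \<tau>)"
      using R x unfolding cont_incr_2_iff level.continuous_map_norm_topology_iff by blast
    from tendsto_mult_left[OF this, of C]
    have lim: "((\<lambda>y. C * N \<beta> (?f y - ?f x)) \<longlongrightarrow> 0) (at x within triangle \<tau>)" by simp
    show "((\<lambda>y. N \<alpha> (?f y - ?f x)) \<longlongrightarrow> 0) (at x within triangle \<tau>)"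
    proof (rule Lim_null_comparison[OF _ lim], unfold eventually_at_filter,
        intro always_eventually allI impI)
      fix y assume "y \<in> triangle \<tau>"
      then have "?f y - ?f x \<in> B \<beta>" using mem x level.diff_mem by blast
      then show "norm (N \<alpha> (?f y - ?f x)) \<le> C * N \<beta> (?f y - ?f x)"
        using C level.N_nonneg by fastforce
    qed
  qed
  then show ?thesis using R by (simp add: cont_incr_2_iff)
qed

text \<open>
  At \<open>u = 0\<close> both sides are 0, so the smoothing estimate extends to the closed interval.
\<close>

lemma semigroup_near_identity:
  assumes "\<beta> < \<beta>'" "\<beta>' < \<beta> + 1"
  shows "\<exists>C>0. \<forall>u\<in>{0..T}. \<forall>x\<in>B \<beta>'. N \<beta> (S u x - x) \<le> C * u powr (\<beta>' - \<beta>) * N \<beta>' x"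
proof -
  have "smoothing_on_scale T B N S"
    using semigroup by (simp add: analytic_semigroup_on_scale_def)
  moreover have "\<beta>' - \<beta> \<in> {0<..<1}" using assms by simp
  ultimately obtain C where C: "C > 0" "\<forall>u\<in>{0<..T}. \<forall>x\<in>B (\<beta> + (\<beta>' - \<beta>)).
      N \<beta> (S u x - x) \<le> C * u powr (\<beta>' - \<beta>) * N (\<beta> + (\<beta>' - \<beta>)) x"
    unfolding smoothing_on_scale_def by blast
  have "N \<beta> (S u x - x) \<le> C * u powr (\<beta>' - \<beta>) * N \<beta>' x" if "u \<in> {0..T}" "x \<in> B \<beta>'" for u x
  proof (cases "u = 0")
    case True
    then show ?thesis using that level.S_0[of x \<beta>'] level.N_zero[of \<beta>] by simp
  next
    case False
    then show ?thesis using C that by simp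
  qed
  then show ?thesis using C by blast
qed

text \<open>
  At a point \<open>(t, s)\<close>, freeze at a time \<open>\<tau>\<close> which is later than \<open>t\<close> by a small \<open>\<eta>\<close> (or at \<open>T\<close>). All nearby
  points of the triangle have their later time in \<open>{\<tau> - 2 * \<eta>..\<tau>}\<close>, where the bound in the stronger norm
  makes the error of freezing uniformly small. The choice \<open>\<tau> = t\<close> would miss the nearby points with a
  later time than \<open>t\<close>.
\<close>

lemma cont_incr_if_frozen_cont_incr:
  assumes ext: "R \<in> extensional (simplex_times 2 T)"
    and \<beta>: "\<beta> < \<beta>'" "\<beta>' < \<beta> + 1"
    and mem: "\<And>t s. 0 \<le> s \<Longrightarrow> s \<le> t \<Longrightarrow> t \<le> T \<Longrightarrow> R [t, s] \<in> B \<beta>'"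
    and bound: "\<And>t s. 0 \<le> s \<Longrightarrow> s \<le> t \<Longrightarrow> t \<le> T \<Longrightarrow> N \<beta>' (R [t, s]) \<le> K"
    and frozen: "\<And>\<tau>. 0 \<le> \<tau> \<Longrightarrow> \<tau> \<le> T \<Longrightarrow> Theta S 2 \<tau> R \<in> cont_incr 2 \<tau> (B \<beta>) (N \<beta>)"
  shows "R \<in> cont_incr 2 T (B \<beta>) (N \<beta>)"
proof -
  let ?f = "\<lambda>(t, s). R [t, s]"
  let ?g = "\<lambda>\<tau> (t, s). Theta S 2 \<tau> R [t, s]"
  have incl: "x \<in> B \<beta>" if "x \<in> B \<beta>'" for x
    using scale \<beta> that unfolding banach_scale_def by (meson less_imp_le subsetD)
  have fV: "?f y \<in> B \<beta>" if "y \<in> triangle T" for y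
    using that mem incl by (auto simp: triangle_def)
  have g_eq: "?g \<tau> y = S (\<tau> - fst y) (?f y)" if "y \<in> triangle \<tau>" for \<tau> y
    using that by (auto simp: triangle_def Theta_2)
  have K: "K \<ge> 0"
    using bound[of 0 0] mem[of 0 0] level.N_nonneg[of "R [0, 0]" \<beta>'] T_pos by linarith
  obtain C where C: "C > 0"
    "\<And>u x. u \<in> {0..T} \<Longrightarrow> x \<in> B \<beta>' \<Longrightarrow> N \<beta> (S u x - x) \<le> C * u powr (\<beta>' - \<beta>) * N \<beta>' x"
    using semigroup_near_identity[OF \<beta>] by blast
  have freeze: "N \<beta> (?g \<tau> y - ?f y) \<le> C * d powr (\<beta>' - \<beta>) * K"
    if y: "y \<in> triangle \<tau>" and \<tau>: "\<tau> \<le> T" and d: "\<tau> - fst y \<le> d" for \<tau> y d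
  proof -
    obtain t s where ts: "y = (t, s)" and o: "0 \<le> s" "s \<le> t" "t \<le> \<tau>"
      using y by (auto simp: triangle_def)
    have "N \<beta> (?g \<tau> y - ?f y) = N \<beta> (S (\<tau> - t) (R [t, s]) - R [t, s])"
      using o by (simp add: ts Theta_2)
    also have "\<dots> \<le> C * (\<tau> - t) powr (\<beta>' - \<beta>) * N \<beta>' (R [t, s])"
      using o \<tau> by (intro C(2) mem) auto
    also have "\<dots> \<le> C * d powr (\<beta>' - \<beta>) * K"
      using C(1) K o \<tau> d \<beta> ts level.N_nonneg mem
      by (intro mult_mono powr_mono2 bound mult_nonneg_nonneg) auto
    finally show ?thesis .
  qed
  have "continuous_map (top_of_set (triangle T)) (norm_topology (B \<beta>) (N \<beta>)) ?f"
    unfolding level.continuous_map_norm_topology_iff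
  proof (intro ballI conjI)
    fix x assume x: "x \<in> triangle T"
    show "?f x \<in> B \<beta>" using fV x .
    show "((\<lambda>y. N \<beta> (?f y - ?f x)) \<longlongrightarrow> 0) (at x within triangle T)"
    proof (rule tendstoI)
      fix e :: real assume e: "e > 0"
      (* q is the admissible size of (2 * \<eta>) powr (\<beta>' - \<beta>): it makes each of the two freezing
         errors smaller than e / 3; the 1 guards against C * K = 0. *)
      define q where "q = e / (3 * (C * K + 1))"
      have CK: "0 \<le> C * K" using C K by simp
      have q: "q > 0" "C * q * K < e / 3"
        using e CK by (auto simp: q_def field_simps)
      define \<eta> where "\<eta> = q powr (1 / (\<beta>' - \<beta>)) / 2"
      have \<eta>: "\<eta> > 0" "(2 * \<eta>) powr (\<beta>' - \<beta>) = q"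
        using q \<beta> by (simp_all add: \<eta>_def powr_powr)
      define \<tau> where "\<tau> = min T (fst x + \<eta>)"
      have \<tau>: "0 \<le> \<tau>" "\<tau> \<le> T" using x \<eta> T_pos by (auto simp: \<tau>_def triangle_def)
      have x\<tau>: "x \<in> triangle \<tau>" using x \<eta> by (auto simp: \<tau>_def triangle_def)
      let ?W = "{y :: real \<times> real. fst x - \<eta> < fst y \<and> fst y < fst x + \<eta>}"
      have W: "open ?W" "x \<in> ?W"
        using \<eta> by (auto intro!: open_Collect_conj open_Collect_less continuous_intros)
      (* Near x the two triangles coincide, so the limit known on the one holds on the other. *)
      have eq: "at x within triangle \<tau> = at x within triangle T"
        by (rule at_within_nhd[OF W(2) W(1)]) (auto simp: triangle_def \<tau>_def)
      have "((\<lambda>y. N \<beta> (?g \<tau> y - ?g \<tau> x)) \<longlongrightarrow> 0) (at x within triangle \<tau>)"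
        using frozen[OF \<tau>] x\<tau> unfolding cont_incr_2_iff level.continuous_map_norm_topology_iff
        by blast
      then have "\<forall>\<^sub>F y in at x within triangle T. N \<beta> (?g \<tau> y - ?g \<tau> x) < e / 3"
        unfolding eq using e by (intro order_tendstoD) auto
      moreover have "\<forall>\<^sub>F y in at x within triangle T. y \<in> ?W \<and> y \<in> triangle T"
        using W unfolding eventually_at_topological by blast
      ultimately show "\<forall>\<^sub>F y in at x within triangle T. dist (N \<beta> (?f y - ?f x)) 0 < e"
      proof eventually_elim
        case (elim y)
        then have y: "y \<in> triangle T" and near: "fst x - \<eta> < fst y" "fst y < fst x + \<eta>" by auto
        then have y\<tau>: "y \<in> triangle \<tau>" by (auto simp: \<tau>_def triangle_def)
        have gV: "?g \<tau> z \<in> B \<beta>" if "z \<in> triangle \<tau>" for z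
          using level.cont_incr_2_mem[OF frozen[OF \<tau>]] that by (auto simp: triangle_def)
        have d: "\<tau> - fst y \<le> 2 * \<eta>" "\<tau> - fst x \<le> 2 * \<eta>" using near \<eta> by (auto simp: \<tau>_def)
        have 1: "N \<beta> (?g \<tau> z - ?f z) < e / 3" if "z \<in> triangle \<tau>" "\<tau> - fst z \<le> 2 * \<eta>" for z
          using freeze[OF that(1) \<tau>(2) that(2)] q \<eta> by simp
        have "N \<beta> (?f y - ?f x) \<le> N \<beta> (?f y - ?g \<tau> y) + N \<beta> (?g \<tau> y - ?f x)"
          using level.N_triangle fV[OF y] fV[OF x] gV[OF y\<tau>] by blast
        also have "N \<beta> (?g \<tau> y - ?f x) \<le> N \<beta> (?g \<tau> y - ?g \<tau> x) + N \<beta> (?g \<tau> x - ?f x)"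
          using level.N_triangle gV[OF x\<tau>] fV[OF x] gV[OF y\<tau>] by blast
        also have "N \<beta> (?f y - ?g \<tau> y) = N \<beta> (?g \<tau> y - ?f y)"
          using level.N_commute fV[OF y] gV[OF y\<tau>] by blast
        finally have "N \<beta> (?f y - ?f x) < e"
          using 1[OF x\<tau> d(2)] 1[OF y\<tau> d(1)] elim(1) by linarith
        then show ?case
          using level.N_nonneg[OF level.diff_mem[OF fV[OF y] fV[OF x]]] by simp
      qed
    qed
  qed
  then show ?thesis using ext by (simp add: cont_incr_2_iff)
qed

lemma unfreeze_incr_norm_finite:
  assumes R: "R \<in> cont_incr 2 T (B \<alpha>) (N \<alpha>)"
    and fin: "(SUP \<tau>\<in>{0..T}. incr_norm w \<tau> N' (frozen_map S T R \<tau>)) < \<infinity>"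
  shows "incr_norm w T N' R < \<infinity>"
  using incr_norm_le_SUP_incr_norm_frozen_map[of T S R w N'] fin
    level.S_0 level.cont_incr_2_mem[OF R] by (meson order.strict_trans1)

lemma C_log_if_frozen_log_finite:
  assumes R: "R \<in> cont_incr 2 T (B \<alpha>) (N \<alpha>)"
    and fin: "(SUP \<tau>\<in>{0..T}. log_norm \<tau> (N \<alpha>) (frozen_map S T R \<tau>)) < \<infinity>"
  shows "R \<in> C_log T (B \<alpha>) (N \<alpha>)"
  using R unfreeze_incr_norm_finite[OF R] fin by (simp add: C_log_def log_norm_eq_incr_norm)

text \<open>
  Off the diagonal the bound is the Hoelder estimate. On the diagonal, \<open>R\<close> vanishes: this is shown in
  the weaker space \<open>B \<alpha>\<close>, the only one in which \<open>R\<close> is known to be continuous.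
\<close>

lemma bounded_if_frozen_holder:
  assumes R: "R \<in> cont_incr 2 T (B \<alpha>) (N \<alpha>)" and "\<alpha> \<le> \<beta>" and \<mu>: "0 < \<mu>"
    and mem: "\<And>t s. 0 \<le> s \<Longrightarrow> s \<le> t \<Longrightarrow> t \<le> T \<Longrightarrow> R [t, s] \<in> B \<beta>"
    and fin: "(SUP \<tau>\<in>{0..T}. holder_norm \<tau> (N \<beta>) \<mu> (frozen_map S T R \<tau>)) < \<infinity>"
  obtains K where "\<And>t s. 0 \<le> s \<Longrightarrow> s \<le> t \<Longrightarrow> t \<le> T \<Longrightarrow> N \<beta> (R [t, s]) \<le> K"
proof -
  have "incr_norm (\<lambda>x. x powr \<mu>) T (N \<beta>) R < \<infinity>"
    using unfreeze_incr_norm_finite[OF R] fin by (simp add: holder_norm_eq_incr_norm)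
  then obtain C where C: "0 \<le> C"
      "\<And>t s. 0 \<le> s \<Longrightarrow> s < t \<Longrightarrow> t \<le> T \<Longrightarrow> N \<beta> (R [t, s]) \<le> C * (t - s) powr \<mu>"
    by (rule incr_norm_finiteE) auto
  obtain C' where C': "\<And>x. x \<in> B \<beta> \<Longrightarrow> N \<alpha> x \<le> C' * N \<beta> x"
    using scale \<open>\<alpha> \<le> \<beta>\<close> unfolding banach_scale_def by blast
  have "N \<alpha> (R [t, s]) \<le> (\<bar>C'\<bar> * C) * (t - s) powr \<mu>" if o: "0 \<le> s" "s < t" "t \<le> T" for t s
  proof -
    have m: "R [t, s] \<in> B \<beta>" using o by (intro mem) auto
    have "N \<alpha> (R [t, s]) \<le> \<bar>C'\<bar> * N \<beta> (R [t, s])"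
      using C'[OF m] level.N_nonneg[OF m] mult_right_mono[OF abs_ge_self[of C']] by fastforce
    also have "\<dots> \<le> \<bar>C'\<bar> * (C * (t - s) powr \<mu>)"
      using C(2)[OF o] by (rule mult_left_mono) simp
    finally show ?thesis by (simp add: mult.assoc)
  qed
  from level.incr_zero_on_diagonal[OF R T_pos \<mu> this]
  have diag: "R [t, t] = 0" if "0 \<le> t" "t \<le> T" for t using that by blast
  have "N \<beta> (R [t, s]) \<le> C * T powr \<mu>" if o: "0 \<le> s" "s \<le> t" "t \<le> T" for t s
  proof (cases "s = t")
    case True
    then show ?thesis using diag o level.N_zero C(1) by simp
  next
    case False
    then have "N \<beta> (R [t, s]) \<le> C * (t - s) powr \<mu>" using C(2) o by simp
    also have "\<dots> \<le> C * T powr \<mu>"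
      using o \<mu> C(1) by (intro mult_left_mono powr_mono2) auto
    finally show ?thesis .
  qed
  then show ?thesis using that by blast
qed

text \<open>
  Continuity in \<open>B (\<alpha> + \<epsilon>)\<close> uses the assumptions for some \<open>\<epsilon>' > \<epsilon>\<close>, which exists because they are
  made on the whole open interval \<open>{0<..<\<gamma>}\<close>. As \<open>\<gamma> \<le> 1\<close>, the gap \<open>\<epsilon>' - \<epsilon>\<close> is smaller than 1 and the
  smoothing estimate applies.
\<close>

lemma C_holder_if_frozen_holder:
  assumes R: "R \<in> cont_incr 2 T (B \<alpha>) (N \<alpha>)" and \<gamma>: "\<gamma> \<le> 1" and \<epsilon>: "\<epsilon> \<in> {0<..<\<gamma>}"
    and cont: "\<And>\<epsilon> \<tau>. \<epsilon> \<in> {0<..<\<gamma>} \<Longrightarrow> \<tau> \<in> {0..T} \<Longrightarrow>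
      frozen_map S T R \<tau> \<in> cont_incr 2 \<tau> (B (\<alpha> + \<epsilon>)) (N (\<alpha> + \<epsilon>))"
    and fin: "\<And>\<epsilon>. \<epsilon> \<in> {0<..<\<gamma>} \<Longrightarrow>
      (SUP \<tau>\<in>{0..T}. holder_norm \<tau> (N (\<alpha> + \<epsilon>)) (\<gamma> - \<epsilon>) (frozen_map S T R \<tau>)) < \<infinity>"
  shows "R \<in> C_holder (\<gamma> - \<epsilon>) T (B (\<alpha> + \<epsilon>)) (N (\<alpha> + \<epsilon>))"
proof -
  obtain \<epsilon>' where \<epsilon>': "\<epsilon> < \<epsilon>'" "\<epsilon>' < \<gamma>" using dense \<epsilon> by auto
  then have \<epsilon>'_mem: "\<epsilon>' \<in> {0<..<\<gamma>}" using \<epsilon> by auto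
  have mem: "R [t, s] \<in> B (\<alpha> + \<epsilon>')" if "0 \<le> s" "s \<le> t" "t \<le> T" for t s
  proof -
    have "frozen_map S T R t [t, s] = R [t, s]"
      using that level.S_0[OF level.cont_incr_2_mem[OF R that]]
      by (simp add: frozen_map_def Theta_2)
    moreover have "frozen_map S T R t [t, s] \<in> B (\<alpha> + \<epsilon>')"
      using that by (intro level.cont_incr_2_mem[OF cont[OF \<epsilon>'_mem]]) auto
    ultimately show ?thesis by simp
  qed
  have "\<alpha> \<le> \<alpha> + \<epsilon>'" "0 < \<gamma> - \<epsilon>'" using \<epsilon>' \<epsilon> by auto
  from bounded_if_frozen_holder[OF R this mem fin[OF \<epsilon>'_mem]]
  obtain K where K: "\<And>t s. 0 \<le> s \<Longrightarrow> s \<le> t \<Longrightarrow> t \<le> T \<Longrightarrow> N (\<alpha> + \<epsilon>') (R [t, s]) \<le> K"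
    by blast
  have "R \<in> cont_incr 2 T (B (\<alpha> + \<epsilon>)) (N (\<alpha> + \<epsilon>))"
  proof (rule cont_incr_if_frozen_cont_incr[where \<beta>' = "\<alpha> + \<epsilon>'" and K = K])
    show "\<alpha> + \<epsilon>' < \<alpha> + \<epsilon> + 1" using \<epsilon>' \<epsilon> \<gamma> by auto
    show "Theta S 2 \<tau> R \<in> cont_incr 2 \<tau> (B (\<alpha> + \<epsilon>)) (N (\<alpha> + \<epsilon>))" if "0 \<le> \<tau>" "\<tau> \<le> T" for \<tau>
      using cont[OF \<epsilon>, of \<tau>] that by (simp add: frozen_map_def)
  qed (use \<epsilon>' K mem cont_incr_extensional[OF R] in auto)
  moreover have "holder_norm T (N (\<alpha> + \<epsilon>)) (\<gamma> - \<epsilon>) R < \<infinity>"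
    using unfreeze_incr_norm_finite[OF R] fin[OF \<epsilon>] by (simp add: holder_norm_eq_incr_norm)
  ultimately show ?thesis by (simp add: C_holder_def)
qed

lemma E_space_iff_frozen_holder:
  assumes R: "R \<in> cont_incr 2 T (B \<alpha>) (N \<alpha>)" and \<gamma>: "\<gamma> \<le> 1"
  shows "R \<in> E_space \<gamma> T B N \<alpha> \<longleftrightarrow> frozen_holder \<gamma> T B N \<alpha> (frozen_map S T R)"
proof
  assume "R \<in> E_space \<gamma> T B N \<alpha>"
  then show "frozen_holder \<gamma> T B N \<alpha> (frozen_map S T R)"
    using level.frozen_map_incr_norm_finite[of R T _ "\<lambda>x. x powr _"]
    by (auto simp: E_space_def frozen_holder_def C_holder_def holder_norm_eq_incr_norm)
next
  assume "frozen_holder \<gamma> T B N \<alpha> (frozen_map S T R)"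
  then show "R \<in> E_space \<gamma> T B N \<alpha>"
    unfolding E_space_def frozen_holder_def
    by (intro INT_I C_holder_if_frozen_holder[OF R \<gamma>]) (auto simp: C_holder_def)
qed

lemma E_log_space_iff_frozen_log:
  assumes R: "R \<in> cont_incr 2 T (B \<alpha>) (N \<alpha>)"
  shows "R \<in> E_log_space T B N \<alpha> \<longleftrightarrow> frozen_log T B N \<alpha> (frozen_map S T R)"
proof
  assume E: "R \<in> E_log_space T B N \<alpha>"
  then have "R \<in> E_space 1 T B N \<alpha>" by (simp add: E_log_space_def E_space_def)
  then have "frozen_holder 1 T B N \<alpha> (frozen_map S T R)"
    using E_space_iff_frozen_holder[OF R] by simp
  moreover have "log_norm T (N \<alpha>) R < \<infinity>" using E by (simp add: E_log_space_def C_log_def)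
  then have "incr_norm (\<lambda>x. x * (1 + \<bar>ln x\<bar>)) T (N \<alpha>) R < \<infinity>"
    by (simp add: log_norm_eq_incr_norm)
  from level.frozen_map_incr_norm_finite[OF R _ this]
  have "(SUP \<tau>\<in>{0..T}. log_norm \<tau> (N \<alpha>) (frozen_map S T R \<tau>)) < \<infinity>"
    and "\<And>\<tau>. \<tau> \<in> {0..T} \<Longrightarrow> frozen_map S T R \<tau> \<in> C_log \<tau> (B \<alpha>) (N \<alpha>)"
    by (simp_all add: C_log_def log_norm_eq_incr_norm)
  ultimately show "frozen_log T B N \<alpha> (frozen_map S T R)"
    by (simp add: frozen_log_def frozen_holder_def)
next
  assume L: "frozen_log T B N \<alpha> (frozen_map S T R)"
  then have "frozen_holder 1 T B N \<alpha> (frozen_map S T R)"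
    by (simp add: frozen_log_def frozen_holder_def)
  then have "R \<in> E_space 1 T B N \<alpha>" using E_space_iff_frozen_holder[OF R] by simp
  moreover have "(1 / 2 :: real) \<in> {0<..<1}" by simp
  with L have "(SUP \<tau>\<in>{0..T}. log_norm \<tau> (N \<alpha>) (frozen_map S T R \<tau>)) < \<infinity>"
    unfolding frozen_log_def by fastforce
  then have "R \<in> C_log T (B \<alpha>) (N \<alpha>)" using C_log_if_frozen_log_finite[OF R] by simp
  ultimately show "R \<in> E_log_space T B N \<alpha>" by (simp add: E_log_space_def E_space_def)
qed

lemma E_space_subset:
  assumes "0 < \<gamma>"
  shows "E_space \<gamma> T B N \<alpha> \<subseteq> cont_incr 2 T (B \<alpha>) (N \<alpha>)"
proof
  fix R assume "R \<in> E_space \<gamma> T B N \<alpha>"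
  moreover have "\<gamma> / 2 \<in> {0<..<\<gamma>}" using assms by simp
  ultimately have "R \<in> cont_incr 2 T (B (\<alpha> + \<gamma> / 2)) (N (\<alpha> + \<gamma> / 2))"
    unfolding E_space_def C_holder_def by blast
  then show "R \<in> cont_incr 2 T (B \<alpha>) (N \<alpha>)"
    using assms by (intro cont_incr_weaker_norm[of \<alpha> "\<alpha> + \<gamma> / 2"]) auto
qed

end

section \<open>The correspondence\<close>

lemma bij_betw_restrict_iff:
  assumes "bij_betw f A A'" and "X \<subseteq> A" and "\<And>x. x \<in> A \<Longrightarrow> x \<in> X \<longleftrightarrow> P (f x)"
  shows "bij_betw f X {y \<in> A'. P y}"
  using assms by (auto simp: bij_betw_def inj_on_def)

theorem theorem3p8:
  fixes T \<alpha> :: real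
    and B :: "real \<Rightarrow> 'a::real_vector set"
    and N :: "real \<Rightarrow> 'a \<Rightarrow> real"
    and S :: "real \<Rightarrow> 'a \<Rightarrow> 'a"
    and h :: "real list \<Rightarrow> 'a"
  assumes "T > 0"
    and "banach_scale B N"
    and "analytic_semigroup_on_scale T B N S"
    and "h \<in> ZC3 S T (B \<alpha>) (N \<alpha>)"
  shows
    "bij_betw (frozen_map S T)
       {R \<in> cont_incr 2 T (B \<alpha>) (N \<alpha>). delta_hat S 2 T R = h}
       (frozen_families S T (B \<alpha>) (N \<alpha>) h)
     \<and> (\<forall>r \<in> frozen_families S T (B \<alpha>) (N \<alpha>) h.
          inv_into {R \<in> cont_incr 2 T (B \<alpha>) (N \<alpha>). delta_hat S 2 T R = h} (frozen_map S T) r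
            = unfreeze T r)
     \<and> (\<forall>\<gamma>\<in>{0<..<1}. h \<in> ZC3_holder S \<gamma> T (B \<alpha>) (N \<alpha>) \<longrightarrow>
          E_space \<gamma> T B N \<alpha> \<subseteq> cont_incr 2 T (B \<alpha>) (N \<alpha>) \<and>
          bij_betw (frozen_map S T)
            {R \<in> E_space \<gamma> T B N \<alpha>. delta_hat S 2 T R = h}
            {r \<in> frozen_families S T (B \<alpha>) (N \<alpha>) h. frozen_holder \<gamma> T B N \<alpha> r})
     \<and> (h \<in> ZC3_holder S 1 T (B \<alpha>) (N \<alpha>) \<longrightarrow>
          E_log_space T B N \<alpha> \<subseteq> cont_incr 2 T (B \<alpha>) (N \<alpha>) \<and>
          bij_betw (frozen_map S T)
            {R \<in> E_log_space T B N \<alpha>. delta_hat S 2 T R = h}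
            {r \<in> frozen_families S T (B \<alpha>) (N \<alpha>) h. frozen_log T B N \<alpha> r})"
proof -
  interpret banach_scale_semigroup T B N S
    using assms by unfold_locales
  let ?A = "{R \<in> cont_incr 2 T (B \<alpha>) (N \<alpha>). delta_hat S 2 T R = h}"
  let ?F = "frozen_families S T (B \<alpha>) (N \<alpha>) h"
  have h: "h \<in> cont_incr 3 T (B \<alpha>) (N \<alpha>)" using assms(4) by (simp add: ZC3_def)
  have bij: "bij_betw (frozen_map S T) ?A ?F"
    using h by (rule level.bij_betw_frozen_map)
  moreover have "inv_into ?A (frozen_map S T) r = unfreeze T r" if r: "r \<in> ?F" for r
    using bij r by (intro inv_into_f_eq)
      (auto simp: bij_betw_def level.unfreeze_cont_incr[OF r] level.delta_hat_unfreeze[OF r h]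
        level.frozen_map_unfreeze[OF r])
  moreover have "E_space \<gamma> T B N \<alpha> \<subseteq> cont_incr 2 T (B \<alpha>) (N \<alpha>) \<and>
      bij_betw (frozen_map S T) {R \<in> E_space \<gamma> T B N \<alpha>. delta_hat S 2 T R = h}
        {r \<in> ?F. frozen_holder \<gamma> T B N \<alpha> r}" if \<gamma>: "\<gamma> \<in> {0<..<1}" for \<gamma>
  proof
    show sub: "E_space \<gamma> T B N \<alpha> \<subseteq> cont_incr 2 T (B \<alpha>) (N \<alpha>)"
      using E_space_subset \<gamma> by simp
    show "bij_betw (frozen_map S T) {R \<in> E_space \<gamma> T B N \<alpha>. delta_hat S 2 T R = h}
        {r \<in> ?F. frozen_holder \<gamma> T B N \<alpha> r}"
      by (rule bij_betw_restrict_iff[OF bij]) (use sub \<gamma> E_space_iff_frozen_holder in auto)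
  qed
  moreover have "E_log_space T B N \<alpha> \<subseteq> cont_incr 2 T (B \<alpha>) (N \<alpha>) \<and>
      bij_betw (frozen_map S T) {R \<in> E_log_space T B N \<alpha>. delta_hat S 2 T R = h}
        {r \<in> ?F. frozen_log T B N \<alpha> r}"
  proof
    show sub: "E_log_space T B N \<alpha> \<subseteq> cont_incr 2 T (B \<alpha>) (N \<alpha>)"
      by (auto simp: E_log_space_def C_log_def)
    show "bij_betw (frozen_map S T) {R \<in> E_log_space T B N \<alpha>. delta_hat S 2 T R = h}
        {r \<in> ?F. frozen_log T B N \<alpha> r}"
      by (rule bij_betw_restrict_iff[OF bij]) (use sub E_log_space_iff_frozen_log in auto)
  qed
  ultimately show ?thesis by blast
qed

end
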